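(* Let $\mathbb X=\{X_Q\}_{Q\subset\mathbb R^n}$ be a family of quasi-Banach function spaces, $X_Q$ over $(Q,dx)$ for each cube $Q$, normalized in the sense that $c_0\le\|\chi_Q\|_{X_Q}\le C_0$ for all cubes $Q$ with constants $0<c_0\le C_0<\infty$. Assume there exist $0<\rho\le1$ and $C_\rho\ge1$, independent of $Q$, such that for every cube $Q$ and every finite collection $\{h_j\}_{j=1}^N\subset X_Q$, $$\Big\|\sum_{j=1}^N h_j\Big\|_{X_Q}^\rho\le C_\rho\sum_{j=1}^N\|h_j\|_{X_Q}^\rho .$$ Suppose that $$\int_0^1\frac{\Psi_{\mathbb X}(t)^\rho}{t}\,dt<\infty .$$ Then, for every $0<\eta<1$, $T_{\mathbb X}(\eta)<\infty$. Consequently, $$BMO\hookrightarrow BMO_{\mathbb X}.$$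
   Context: Cubes in $\mathbb R^n$ have sides parallel to the coordinate axes; functions are real-valued and measurable; $\langle f\rangle_Q=\frac1{|Q|}\int_Q f$. A quasi-Banach function space over a measure space $\Omega$ is a quasi-normed lattice $X\subset L^0(\Omega)$ such that: (1) if $|f|\le|g|$ a.e. and $g\in X$, then $f\in X$ and $\|f\|_X\le\|g\|_X$; (2) $\|f+g\|_X\le C_X(\|f\|_X+\|g\|_X)$ for some $C_X\ge1$; (3) (Fatou) if $0\le f_j\uparrow f$ a.e. and $\sup_j\|f_j\|_X<\infty$, then $f\in X$ and $\|f\|_X=\sup_j\|f_j\|_X$. The expression $\|g\chi_Q\|_{X_Q}$ denotes the $X_Q$-quasi-norm of the restriction of $g$ to $Q$ (value $+\infty$ if it is not in $X_Q$). For $0<t<1$, $$\Psi_{\mathbb X}(t):=\sup_Q\sup_{E\subset Q,\ |E|\le t|Q|}\frac{\|\chi_E\|_{X_Q}}{\|\chi_Q\|_{X_Q}}.$$ $\mathcal D(Q)$ is the collection of dyadic subcubes of $Q$, obtained by repeatedly subdividing $Q$ into $2^n$ congruent subcubes. For $\mathcal S\subset\mathcal D(Q)$ and $P\in\mathcal S$, $\operatorname{ch}_{\mathcal S}(P)$ is the collection of maximal cubes $R\in\mathcal S$ with $R\subsetneq P$. For $0<\eta<1$, $\mathcal S$ is $\eta$-sparse if $\sum_{R\in\operatorname{ch}_{\mathcal S}(P)}|R|\le(1-\eta)|P|$ for every $P\in\mathcal S$. The sparse testing seminorm is $$T_{\mathbb X}(\eta):=\sup_Q\ \sup_{\mathcal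 S\subset\mathcal D(Q),\ \mathcal S\ \eta\text{-sparse}}\Big\|\sum_{P\in\mathcal S}\chi_P\Big\|_{X_Q}.$$ $\|f\|_{BMO}:=\sup_Q\frac1{|Q|}\int_Q|f-\langle f\rangle_Q|\,dx$ and $\|f\|_{BMO_{\mathbb X}}:=\sup_Q\|(f-\langle f\rangle_Q)\chi_Q\|_{X_Q}$ for $f\in L^1_{\mathrm{loc}}(\mathbb R^n)$; $BMO$ and $BMO_{\mathbb X}$ consist of the locally integrable $f$ for which these are finite. $A\hookrightarrow B$ denotes continuous embedding (with respect to the seminorms). *)

theory Defs
  imports "HOL-Analysis.Analysis"
begin

text \<open>Cubes are taken half-open, so that the \<open>2^n\<close> congruent subcubes of a cube partition it.
  Everything below is insensitive to null sets, so this convention is immaterial.\<close>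

definition cube :: "real ^ 'n \<Rightarrow> real \<Rightarrow> (real ^ 'n) set" where
  "cube a l = {x. \<forall>i. a $ i \<le> x $ i \<and> x $ i < a $ i + l}"

definition cubes :: "(real ^ 'n) set set" where
  "cubes = {cube a l | a l. l > 0}"

inductive_set dyadic :: "(real ^ 'n) set \<Rightarrow> (real ^ 'n) set set" for Q where
  self: "Q \<in> dyadic Q"
| subdivide: "cube a l \<in> dyadic Q \<Longrightarrow> l > 0 \<Longrightarrow> (\<And>i. e $ i \<in> {0, 1}) \<Longrightarrow>
    cube (a + (l / 2) *\<^sub>R e) (l / 2) \<in> dyadic Q"

definition children :: "(real ^ 'n) set set \<Rightarrow> (real ^ 'n) set \<Rightarrow> (real ^ 'n) set set" where
  "children S P = {R \<in> S. R \<subset> P \<and> \<not> (\<exists>R' \<in> S. R' \<subset> P \<and> R \<subset> R')}"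

definition sparse :: "real \<Rightarrow> (real ^ 'n) set set \<Rightarrow> bool" where
  "sparse \<eta> S \<longleftrightarrow>
     (\<forall>P \<in> S. (\<Sum>\<^sub>\<infinity>R \<in> children S P. emeasure lebesgue R) \<le> ennreal (1 - \<eta>) * emeasure lebesgue P)"

text \<open>Elements of \<open>L\<^sup>0\<close> are represented by measurable real-valued functions; \<open>X\<close> is the set of
  representatives of the members of the space and \<open>N\<close> its quasi-norm, whose values outside \<open>X\<close> are
  irrelevant. The ideal property makes \<open>X\<close> and \<open>N\<close> invariant under a.e. equality; it also makes
  \<open>X\<close> a lattice. For \<open>M = lebesgue_on Q\<close> only the values of a function on \<open>Q\<close> matter, so
  functions on the whole of \<open>\<real>\<^sup>n\<close> may be used to denote their restrictions to \<open>Q\<close>.\<close>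

definition quasi_banach_function_space ::
    "'a measure \<Rightarrow> ('a \<Rightarrow> real) set \<Rightarrow> (('a \<Rightarrow> real) \<Rightarrow> real) \<Rightarrow> bool" where
  "quasi_banach_function_space M X N \<longleftrightarrow>
     X \<subseteq> borel_measurable M
   \<and> (\<lambda>x. 0) \<in> X
   \<and> (\<forall>f\<in>X. \<forall>g\<in>X. (\<lambda>x. f x + g x) \<in> X)
   \<and> (\<forall>f\<in>X. \<forall>c. (\<lambda>x. c * f x) \<in> X \<and> N (\<lambda>x. c * f x) = \<bar>c\<bar> * N f)
   \<and> (\<forall>f\<in>X. 0 \<le> N f \<and> (N f = 0 \<longleftrightarrow> (AE x in M. f x = 0)))
   \<and> (\<forall>f\<in>borel_measurable M. \<forall>g\<in>X. (AE x in M. \<bar>f x\<bar> \<le> \<bar>g x\<bar>) \<longrightarrow> f \<in> X \<and> N f \<le> N g)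
   \<and> (\<exists>C\<ge>1. \<forall>f\<in>X. \<forall>g\<in>X. N (\<lambda>x. f x + g x) \<le> C * (N f + N g))
   \<and> (\<forall>f\<in>borel_measurable M. \<forall>F :: nat \<Rightarrow> 'a \<Rightarrow> real.
        (\<forall>j. F j \<in> X) \<and>
        (AE x in M. (\<forall>j. 0 \<le> F j x) \<and> incseq (\<lambda>j. F j x) \<and> (\<lambda>j. F j x) \<longlonglongrightarrow> f x) \<and>
        bdd_above (range (\<lambda>j. N (F j)))
        \<longrightarrow> f \<in> X \<and> N f = (SUP j. N (F j)))"

definition qnorm :: "('a \<Rightarrow> real) set \<Rightarrow> (('a \<Rightarrow> real) \<Rightarrow> real) \<Rightarrow> ('a \<Rightarrow> real) \<Rightarrow> ennreal" where
  "qnorm X N g = (if g \<in> X then ennreal (N g) else \<infinity>)"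

text \<open>For a \<open>[0,\<infinity>]\<close>-valued function, such as an infinite sum of indicators: it can only belong to the space if it is finite
  a.e., and its values on the exceptional null set do not matter.\<close>

definition qnorm_ennreal ::
    "'a measure \<Rightarrow> ('a \<Rightarrow> real) set \<Rightarrow> (('a \<Rightarrow> real) \<Rightarrow> real) \<Rightarrow> ('a \<Rightarrow> ennreal) \<Rightarrow> ennreal" where
  "qnorm_ennreal M X N F =
     (if AE x in M. F x < \<infinity> then qnorm X N (\<lambda>x. enn2real (F x)) else \<infinity>)"

definition ennreal_powr :: "ennreal \<Rightarrow> real \<Rightarrow> ennreal" where
  "ennreal_powr x r = (if x = \<infinity> then \<infinity> else ennreal (enn2real x powr r))"

definition Psi ::
    "((real ^ 'n) set \<Rightarrow> (real ^ 'n \<Rightarrow> real) set) \<Rightarrow> ((real ^ 'n) set \<Rightarrow> (real ^ 'n \<Rightarrow> real) \<Rightarrow> real) \<Rightarrow>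
     real \<Rightarrow> ennreal" where
  "Psi X N t =
     (SUP Q \<in> cubes. SUP E \<in> {E \<in> sets lebesgue. E \<subseteq> Q \<and> measure lebesgue E \<le> t * measure lebesgue Q}.
        qnorm (X Q) (N Q) (indicator E) / qnorm (X Q) (N Q) (indicator Q))"

definition sparse_testing ::
    "((real ^ 'n) set \<Rightarrow> (real ^ 'n \<Rightarrow> real) set) \<Rightarrow> ((real ^ 'n) set \<Rightarrow> (real ^ 'n \<Rightarrow> real) \<Rightarrow> real) \<Rightarrow>
     real \<Rightarrow> ennreal" where
  "sparse_testing X N \<eta> =
     (SUP Q \<in> cubes. SUP S \<in> {S. S \<subseteq> dyadic Q \<and> sparse \<eta> S}.
        qnorm_ennreal (lebesgue_on Q) (X Q) (N Q) (\<lambda>x. \<Sum>\<^sub>\<infinity>P \<in> S. indicator P x))"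

definition L1_loc :: "(real ^ 'n \<Rightarrow> real) set" where
  "L1_loc = {f \<in> borel_measurable lebesgue. \<forall>K. compact K \<longrightarrow> set_integrable lebesgue K f}"

definition average :: "(real ^ 'n \<Rightarrow> real) \<Rightarrow> (real ^ 'n) set \<Rightarrow> real" where
  "average f Q = (LINT x:Q|lebesgue. f x) / measure lebesgue Q"

definition BMO_norm :: "(real ^ 'n \<Rightarrow> real) \<Rightarrow> ennreal" where
  "BMO_norm f = (SUP Q \<in> cubes. ennreal (average (\<lambda>x. \<bar>f x - average f Q\<bar>) Q))"

definition BMO :: "(real ^ 'n \<Rightarrow> real) set" where
  "BMO = {f \<in> L1_loc. BMO_norm f < \<infinity>}"

definition BMO_X_norm ::
    "((real ^ 'n) set \<Rightarrow> (real ^ 'n \<Rightarrow> real) set) \<Rightarrow> ((real ^ 'n) set \<Rightarrow> (real ^ 'n \<Rightarrow> real) \<Rightarrow> real) \<Rightarrow>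
     (real ^ 'n \<Rightarrow> real) \<Rightarrow> ennreal" where
  "BMO_X_norm X N f =
     (SUP Q \<in> cubes. qnorm (X Q) (N Q) (\<lambda>x. (f x - average f Q) * indicator Q x))"

definition BMO_X ::
    "((real ^ 'n) set \<Rightarrow> (real ^ 'n \<Rightarrow> real) set) \<Rightarrow> ((real ^ 'n) set \<Rightarrow> (real ^ 'n \<Rightarrow> real) \<Rightarrow> real) \<Rightarrow>
     (real ^ 'n \<Rightarrow> real) set" where
  "BMO_X X N = {f \<in> L1_loc. BMO_X_norm X N f < \<infinity>}"

text \<open>Continuity of the inclusion of seminormed spaces is boundedness.\<close>

definition continuously_embedded ::
    "'a set \<Rightarrow> ('a \<Rightarrow> ennreal) \<Rightarrow> 'a set \<Rightarrow> ('a \<Rightarrow> ennreal) \<Rightarrow> bool" where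
  "continuously_embedded A p B q \<longleftrightarrow>
     A \<subseteq> B \<and> (\<exists>C::real. C \<ge> 0 \<and> (\<forall>f\<in>A. q f \<le> ennreal C * p f))"

end

theory Submission
  imports Defs
begin

text \<open>
  Both conclusions say that a function \<open>g\<close> on a cube \<open>Q\<close> has a quasi-norm bounded independently of
  \<open>Q\<close>, and in both cases the reason is that the level sets of \<open>g\<close> decay geometrically:
  \<open>|{x \<in> Q. |g x| > k}| \<le> \<gamma>\<^sup>k |Q|\<close> for all naturals \<open>k\<close>, with a fixed \<open>\<gamma> < 1\<close>. Since \<open>|g|\<close> is at most the sum
  of the indicators of these level sets, and the \<open>k\<close>-th indicator has quasi-norm at most a constant
  times \<open>\<Psi>(\<gamma>\<^sup>k)\<close>, the \<open>\<rho>\<close>-triangle inequality bounds the \<open>\<rho>\<close>-th power of the quasi-norm by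
  \<open>\<Sum>\<^sub>k \<Psi>(\<gamma>\<^sup>k)\<^sup>\<rho>\<close>. As \<open>\<Psi>\<close> is increasing, this sum is dominated by the integral of \<open>\<Psi>(t)\<^sup>\<rho>/t\<close>
  and hence finite; the Fatou property passes from truncations of \<open>g\<close> to \<open>g\<close>. This is
  \<open>uniform_norm_bound_of_level_decay\<close>.

  It remains to prove the decay. For \<open>g = \<Sum>\<^sub>P \<chi>\<^sub>P\<close> over an \<open>\<eta>\<close>-sparse family it holds with \<open>\<gamma> = 1 - \<eta>\<close>: a
  point lying in more than \<open>k + 1\<close> subcubes of \<open>P\<close> from the family lies in more than \<open>k\<close> of those
  contained in one child of \<open>P\<close>, and the children fill at most the fraction \<open>1 - \<eta>\<close> of \<open>P\<close>
  (\<open>sparse_sum_decay\<close>). For \<open>g = (f - \<langle>f\<rangle>\<^sub>Q) / M\<close>, where \<open>M\<close> is a dimensional constant times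
  the \<open>BMO\<close> norm of \<open>f\<close>, it holds with \<open>\<gamma> = 1/2\<close>: this is the John--Nirenberg inequality, proved by
  stopping at the maximal dyadic subcubes of \<open>Q\<close> on which the average of \<open>|f - \<langle>f\<rangle>\<^sub>Q|\<close> is large. The
  embedding thus follows from the same norm bound, without passing through a sparse domination
  of \<open>f - \<langle>f\<rangle>\<^sub>Q\<close>.

  The covering arguments all have the form of \<open>emeasure_Union_le_of_maximals\<close>: the maximal
  members of a family of dyadic cubes are disjoint with the same union as the family, so a comparison
  of two measures on each maximal cube gives the comparison on the union.
\<close>

section \<open>The dyadic grid of a cube\<close>

text \<open>The index \<open>v\<close> ranges over all integer vectors, so the cells of each level tile the whole space; the
  cells that meet \<open>cube a l\<close> are its dyadic subcubes.\<close>

definition grid_cell :: "real ^ 'n \<Rightarrow> real \<Rightarrow> nat \<Rightarrow> int ^ 'n \<Rightarrow> (real ^ 'n) set" where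
  "grid_cell a l m v = cube (a + (l / 2 ^ m) *\<^sub>R (\<chi> i. real_of_int (v $ i))) (l / 2 ^ m)"

definition grid :: "real ^ 'n \<Rightarrow> real \<Rightarrow> (real ^ 'n) set set" where
  "grid a l = (\<Union>m. range (grid_cell a l m))"

text \<open>Membership in terms of integer parts reduces the nesting of cells to iterated integer division by a
  power of two.\<close>

lemma mem_grid_cell:
  assumes "l > 0"
  shows "x \<in> grid_cell a l m v \<longleftrightarrow> (\<forall>i. \<lfloor>2 ^ m * ((x $ i - a $ i) / l)\<rfloor> = v $ i)"
proof -
  have "(a $ i + l / 2 ^ m * real_of_int (v $ i) \<le> x $ i \<and> x $ i < a $ i + l / 2 ^ m * real_of_int (v $ i) + l / 2 ^ m)
     \<longleftrightarrow> \<lfloor>2 ^ m * ((x $ i - a $ i) / l)\<rfloor> = v $ i" for i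
    using assms by (simp add: floor_eq_iff field_simps)
  then show ?thesis
    by (simp add: grid_cell_def cube_def)
qed

lemma grid_cell_0: "grid_cell a l 0 0 = cube a l"
  by (simp add: grid_cell_def cube_def)

lemma grid_cell_mem_cubes: "l > 0 \<Longrightarrow> grid_cell a l m v \<in> cubes"
  unfolding grid_cell_def cubes_def by (auto intro!: exI)

lemma grid_subset_cubes: "l > 0 \<Longrightarrow> grid a l \<subseteq> cubes"
  using grid_cell_mem_cubes by (auto simp: grid_def)

lemma cube_mem_grid: "cube a l \<in> grid a l"
  unfolding grid_def using grid_cell_0 by (metis UNIV_I UN_I rangeI)

lemma cube_nonempty: "l > 0 \<Longrightarrow> cube a l \<noteq> {}"
  by (auto simp: cube_def intro!: exI[of _ a])

lemma cubes_nonempty: "Q \<in> cubes \<Longrightarrow> Q \<noteq> {}"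
  by (auto simp: cubes_def cube_nonempty)

lemma floor_refine:
  fixes y :: real
  assumes "m \<le> m'"
  shows "\<lfloor>2 ^ m * y\<rfloor> = \<lfloor>2 ^ m' * y\<rfloor> div 2 ^ (m' - m)"
proof -
  have "(2::real) ^ m' = 2 ^ (m' - m) * 2 ^ m"
    using assms by (simp flip: power_add)
  then have "2 ^ m * y = 2 ^ m' * y / real_of_int (2 ^ (m' - m))"
    by simp
  then show ?thesis
    by (metis floor_divide_real_eq_div zero_le_numeral zero_le_power)
qed

lemma grid_cell_nested:
  assumes "l > 0" "m \<le> m'" "x \<in> grid_cell a l m v" "x \<in> grid_cell a l m' v'"
  shows "grid_cell a l m' v' \<subseteq> grid_cell a l m v"
  using assms
  by (auto simp: mem_grid_cell floor_refine[OF assms(2)] simp del: times_divide_eq_right)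

lemma grid_nested:
  assumes "l > 0" "R \<in> grid a l" "R' \<in> grid a l" "R \<inter> R' \<noteq> {}"
  shows "R \<subseteq> R' \<or> R' \<subseteq> R"
proof -
  obtain m v m' v' where *: "R = grid_cell a l m v" "R' = grid_cell a l m' v'"
    using assms by (auto simp: grid_def)
  obtain x where x: "x \<in> R" "x \<in> R'"
    using assms by auto
  show ?thesis
    using grid_cell_nested[OF assms(1)] x * by (metis nle_le)
qed

lemma grid_subset_cube:
  assumes "l > 0" "R \<in> grid a l" "R \<inter> cube a l \<noteq> {}"
  shows "R \<subseteq> cube a l"
proof -
  obtain m v where *: "R = grid_cell a l m v"
    using assms by (auto simp: grid_def)
  obtain x where "x \<in> R" "x \<in> cube a l"
    using assms by auto
  then show ?thesis
    using grid_cell_nested[OF assms(1), of 0 m x a 0 v] by (simp add: * grid_cell_0)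
qed

lemma countable_grid: "countable (grid a l)"
  by (simp add: grid_def)

text \<open>By induction on the subdivision. A subdivision step names its cube by a corner and a side length of
  its own, and these have to be identified with the ones from the grid.\<close>

lemma dyadic_subset_grid:
  fixes a :: "real ^ 'n"
  assumes "l > 0" "R \<in> dyadic (cube a l)"
  shows "R \<in> grid a l \<and> R \<subseteq> cube a l"
  using assms(2)
proof (induction rule: dyadic.induct)
  case self
  then show ?case by (simp add: cube_mem_grid)
next
  case (subdivide b s e)
  obtain m v where "cube b s = grid_cell a l m v"
    using subdivide by (auto simp: grid_def)
  define c where "c = a + (l / 2 ^ m) *\<^sub>R (\<chi> i. real_of_int (v $ i))"
  define r where "r = l / 2 ^ m"
  have r: "r > 0" using assms by (simp add: r_def)
  have eq: "cube b s = cube c r"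
    using \<open>cube b s = grid_cell a l m v\<close> by (simp add: grid_cell_def c_def r_def)
  have "b = c \<and> s = r"
  proof
    have "b \<in> cube c r" "c \<in> cube b s"
      unfolding eq by (use eq r \<open>s > 0\<close> in \<open>auto simp: cube_def set_eq_iff\<close>)
    then have bc: "b = c"
      by (auto simp: cube_def vec_eq_iff intro!: antisym)
    then show "b = c" .
    have "\<not> s < r"
    proof
      assume "s < r"
      then have "c + (\<chi> i. s) \<in> cube c r" "c + (\<chi> i. s) \<notin> cube b s"
        using bc \<open>s > 0\<close> by (auto simp: cube_def)
      with eq show False by simp
    qed
    moreover have "\<not> r < s"
    proof
      assume "r < s"
      then have "c + (\<chi> i. r) \<in> cube b s" "c + (\<chi> i. r) \<notin> cube c r"
        using bc r by (auto simp: cube_def)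
      with eq show False by simp
    qed
    ultimately show "s = r" by simp
  qed
  \<comment> \<open>Index of the subcube at the next level: the digits \<open>e\<close> are appended in base two.\<close>
  define w :: "int ^ 'n" where "w = (\<chi> i. 2 * v $ i + (if e $ i = 0 then 0 else 1))"
  have "b $ i + s / 2 * e $ i = a $ i + l / 2 ^ Suc m * real_of_int (w $ i)" for i
  proof -
    have "b $ i = a $ i + l / 2 ^ m * real_of_int (v $ i)" "s = l / 2 ^ m"
      using \<open>b = c \<and> s = r\<close> by (simp_all add: c_def r_def)
    moreover have "e $ i = 0 \<or> e $ i = 1"
      using subdivide(3)[of i] by auto
    ultimately show ?thesis
      by (elim disjE) (simp_all add: w_def field_simps)
  qed
  then have "b + (s / 2) *\<^sub>R e = a + (l / 2 ^ Suc m) *\<^sub>R (\<chi> i. real_of_int (w $ i))"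
    by (simp add: vec_eq_iff)
  then have "cube (b + (s / 2) *\<^sub>R e) (s / 2) = grid_cell a l (Suc m) w"
    using \<open>b = c \<and> s = r\<close> by (simp add: grid_cell_def r_def mult.commute)
  then have "cube (b + (s / 2) *\<^sub>R e) (s / 2) \<in> grid a l"
    by (auto simp: grid_def)
  moreover have "cube (b + (s / 2) *\<^sub>R e) (s / 2) \<subseteq> cube b s"
  proof
    fix x assume x: "x \<in> cube (b + (s / 2) *\<^sub>R e) (s / 2)"
    have "b $ i \<le> x $ i \<and> x $ i < b $ i + s" for i
      using x subdivide(2) subdivide(3)[of i] by (auto simp: cube_def dest!: spec[of _ i])
    then show "x \<in> cube b s" by (auto simp: cube_def)
  qed
  ultimately show ?case using subdivide by auto
qed

lemma cube_between: "box a (a + (\<chi> i. l)) \<subseteq> cube a l" "cube a l \<subseteq> cbox a (a + (\<chi> i. l))"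
  by (auto simp: cube_def mem_box_cart less_imp_le)

lemma cube_borel [measurable]: "cube a l \<in> sets borel"
proof -
  have "cube a l = {x \<in> space borel. \<forall>i. a $ i \<le> x $ i \<and> x $ i < a $ i + l}"
    by (simp add: cube_def)
  also have "\<dots> \<in> sets borel"
    by measurable
  finally show ?thesis .
qed

lemma emeasure_cube:
  fixes a :: "real ^ 'n"
  assumes "l > 0"
  shows "emeasure lebesgue (cube a l) = ennreal (l ^ CARD('n))"
proof -
  have "(\<Prod>b\<in>Basis. (a + (\<chi> i. l) - a) \<bullet> b) = l ^ CARD('n)"
  proof -
    have "(\<Prod>b\<in>Basis. (a + (\<chi> i. l) - a) \<bullet> b) = (\<Prod>b\<in>(Basis::(real^'n) set). l)"
      by (intro prod.cong) (auto simp: Basis_vec_def inner_axis)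
    then show ?thesis by simp
  qed
  moreover have "\<forall>b\<in>Basis. a \<bullet> b \<le> (a + (\<chi> i. l)) \<bullet> b"
    using assms by (auto simp: Basis_vec_def inner_axis inner_add_left)
  ultimately have "emeasure lborel (box a (a + (\<chi> i. l))) = ennreal (l ^ CARD('n))"
     "emeasure lborel (cbox a (a + (\<chi> i. l))) = ennreal (l ^ CARD('n))"
    by (simp_all add: emeasure_lborel_box_eq emeasure_lborel_cbox_eq)
  moreover have "emeasure lborel (box a (a + (\<chi> i. l))) \<le> emeasure lborel (cube a l)"
    "emeasure lborel (cube a l) \<le> emeasure lborel (cbox a (a + (\<chi> i. l)))"
    by (intro emeasure_mono cube_between; simp)+
  ultimately show ?thesis
    by simp
qed

lemma cubes_lmeasurable:
  assumes "Q \<in> cubes"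
  shows "Q \<in> lmeasurable" "measure lebesgue Q > 0"
proof -
  obtain a l where Q: "Q = cube a l" "l > 0"
    using assms by (auto simp: cubes_def)
  show "Q \<in> lmeasurable"
    using Q emeasure_cube[of l a] by (intro fmeasurableI) auto
  show "measure lebesgue Q > 0"
    using Q emeasure_cube[of l a] by (simp add: measure_def)
qed

lemma grid_measurable: "l > 0 \<Longrightarrow> R \<in> grid a l \<Longrightarrow> R \<in> sets lebesgue"
  using cubes_lmeasurable(1) grid_subset_cubes by (metis fmeasurableD subsetD)

lemma grid_parent:
  fixes a :: "real ^ 'n"
  assumes l: "l > 0" and R: "R \<in> grid a l" "R \<subset> cube a l"
  shows "\<exists>P \<in> grid a l. R \<subset> P \<and> P \<subseteq> cube a l \<and> emeasure lebesgue P = 2 ^ CARD('n) * emeasure lebesgue R"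
proof -
  obtain m v where R_eq: "R = grid_cell a l m v"
    using R by (auto simp: grid_def)
  obtain x where x: "x \<in> R"
    using R grid_subset_cubes[OF l] cubes_nonempty by blast
  have "m \<noteq> 0"
  proof
    assume "m = 0"
    then have "cube a l \<subseteq> R"
      using grid_cell_nested[OF l, of 0 0 x a v 0] x R by (auto simp: R_eq grid_cell_0)
    with R show False by auto
  qed
  then obtain m' where m: "m = Suc m'"
    using not0_implies_Suc by blast
  define w :: "int ^ 'n" where "w = (\<chi> i. \<lfloor>2 ^ m' * ((x $ i - a $ i) / l)\<rfloor>)"
  define P where "P = grid_cell a l m' w"
  have xP: "x \<in> P"
    by (simp add: P_def w_def mem_grid_cell[OF l])
  have P: "P \<in> grid a l"
    by (auto simp: P_def grid_def)
  have "R \<subseteq> P"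
    using grid_cell_nested[OF l, of m' m x a w v] x xP by (simp add: R_eq P_def m)
  have PQ: "P \<subseteq> cube a l"
    using grid_subset_cube[OF l P] x xP R by blast
  have em: "emeasure lebesgue (grid_cell a l j u) = ennreal ((l / 2 ^ j) ^ CARD('n))" for j and u :: "int ^ 'n"
    unfolding grid_cell_def using l by (intro emeasure_cube) simp
  have "(l / 2 ^ m') ^ CARD('n) = 2 ^ CARD('n) * (l / 2 ^ m) ^ CARD('n)"
    by (simp add: m flip: power_mult_distrib)
  then have eq: "emeasure lebesgue P = 2 ^ CARD('n) * emeasure lebesgue R"
    using l by (simp add: P_def R_eq em ennreal_mult flip: ennreal_power)
  have "R \<noteq> P"
  proof
    assume "R = P"
    then have "ennreal ((l / 2 ^ m) ^ CARD('n)) = ennreal ((l / 2 ^ m') ^ CARD('n))"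
      by (metis R_eq P_def em)
    then have "(l / 2 ^ m) ^ CARD('n) = (l / 2 ^ m') ^ CARD('n)"
      using l by (subst (asm) ennreal_inj) auto
    then have "l / 2 ^ m = l / 2 ^ m'"
      by (rule power_eq_imp_eq_base) (use l in auto)
    then show False
      using l by (simp add: m)
  qed
  with \<open>R \<subseteq> P\<close> P PQ eq show ?thesis
    by blast
qed

section \<open>Maximal cells of a family\<close>

definition maximals :: "'a set set \<Rightarrow> 'a set set" where
  "maximals F = {R \<in> F. \<not> (\<exists>R' \<in> F. R \<subset> R')}"

lemma children_eq_maximals: "children S P = maximals {R \<in> S. R \<subset> P}"
  by (auto simp: children_def maximals_def)

text \<open>Cells get larger as the level decreases, and levels are natural numbers: a member of \<open>F\<close> of least
  level among those containing \<open>R0\<close> is maximal.\<close>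

lemma ex_maximals_superset:
  assumes "l > 0" "F \<subseteq> grid a l" "R0 \<in> F"
  shows "\<exists>R \<in> maximals F. R0 \<subseteq> R"
proof -
  define A where "A m \<longleftrightarrow> (\<exists>v. grid_cell a l m v \<in> F \<and> R0 \<subseteq> grid_cell a l m v)" for m
  have "\<exists>m. A m"
    using assms by (force simp: A_def grid_def)
  then have "A (LEAST m. A m)"
    by (metis LeastI_ex)
  then obtain m v where m: "m = (LEAST m. A m)" "grid_cell a l m v \<in> F" "R0 \<subseteq> grid_cell a l m v"
    by (auto simp: A_def)
  have "\<not> (\<exists>R' \<in> F. grid_cell a l m v \<subset> R')"
  proof
    assume "\<exists>R' \<in> F. grid_cell a l m v \<subset> R'"
    then obtain R' where R': "R' \<in> F" "grid_cell a l m v \<subset> R'" by auto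
    then obtain m' v' where *: "R' = grid_cell a l m' v'"
      using assms by (fastforce simp: grid_def)
    then have "A m'"
      using R' m(3) unfolding A_def by blast
    then have "m \<le> m'"
      unfolding m(1) by (rule Least_le)
    moreover obtain x where "x \<in> grid_cell a l m v"
      using cubes_nonempty[OF grid_cell_mem_cubes[OF assms(1)]] by blast
    ultimately have "R' \<subseteq> grid_cell a l m v"
      using grid_cell_nested[OF assms(1)] R' * by blast
    with R' show False by auto
  qed
  with m show ?thesis
    by (auto simp: maximals_def)
qed

lemma Union_maximals:
  assumes "l > 0" "F \<subseteq> grid a l"
  shows "\<Union>(maximals F) = \<Union>F"
proof
  show "\<Union>F \<subseteq> \<Union>(maximals F)"
    using ex_maximals_superset[OF assms] by blast
qed (auto simp: maximals_def)

lemma maximals_disjoint: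
  assumes "l > 0" "F \<subseteq> grid a l"
  shows "disjoint_family_on (\<lambda>R. R) (maximals F)"
  unfolding disjoint_family_on_def
proof (intro ballI impI)
  fix R R' assume "R \<in> maximals F" "R' \<in> maximals F" "R \<noteq> R'"
  then show "R \<inter> R' = {}"
    using grid_nested[OF assms(1), of R a R'] assms(2) by (auto simp: maximals_def psubset_eq)
qed

lemma emeasure_Union_maximals:
  assumes "l > 0" "F \<subseteq> grid a l" "sets M = sets lebesgue"
  shows "emeasure M (\<Union>F) = (\<integral>\<^sup>+R. emeasure M R \<partial>count_space (maximals F))"
proof -
  have "maximals F \<subseteq> grid a l"
    using assms by (auto simp: maximals_def)
  then have "emeasure M (\<Union>((\<lambda>R. R) ` maximals F)) = (\<integral>\<^sup>+R. emeasure M R \<partial>count_space (maximals F))"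
    using assms(3) maximals_disjoint[OF assms(1,2)] grid_measurable[OF assms(1), of _ a]
    by (intro emeasure_UN_countable) (auto intro: countable_subset[OF _ countable_grid])
  then show ?thesis
    by (simp add: Union_maximals[OF assms(1,2)])
qed

text \<open>All covering arguments below are instances of this comparison, for suitable densities
  in place of \<open>M\<close> and \<open>M'\<close>: the union of \<open>F\<close> is the disjoint union of its maximal cells.\<close>

lemma emeasure_Union_le_of_maximals:
  assumes "l > 0" "F \<subseteq> grid a l" "sets M = sets lebesgue" "sets M' = sets lebesgue"
    and le: "\<And>R. R \<in> maximals F \<Longrightarrow> emeasure M R \<le> c * emeasure M' R"
  shows "emeasure M (\<Union>F) \<le> c * emeasure M' (\<Union>F)"
proof -
  have "(\<integral>\<^sup>+R. emeasure M R \<partial>count_space (maximals F)) \<le> (\<integral>\<^sup>+R. c * emeasure M' R \<partial>count_space (maximals F))"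
    by (intro nn_integral_mono) (use le in auto)
  then show ?thesis
    using assms by (simp add: emeasure_Union_maximals[OF assms(1,2)] nn_integral_cmult)
qed

lemma Union_grid_measurable:
  assumes "l > 0" "F \<subseteq> grid a l"
  shows "\<Union>F \<in> sets lebesgue"
  using assms grid_measurable[OF assms(1)]
  by (intro sets.countable_Union) (auto intro: countable_subset[OF _ countable_grid])

section \<open>Bounding a function by its cell averages\<close>

lemma ex_grid_cell_in_ball:
  fixes x :: "real ^ 'n"
  assumes "l > 0" "r > 0"
  shows "\<exists>P \<in> grid a l. x \<in> P \<and> P \<subseteq> ball x r"
proof -
  obtain m where "real CARD('n) * l / r < 2 ^ m"
    using real_arch_pow[of 2] by auto
  then have m: "real CARD('n) * (l / 2 ^ m) < r"
    using assms by (simp add: field_simps)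
  define v :: "int ^ 'n" where "v = (\<chi> i. \<lfloor>2 ^ m * ((x $ i - a $ i) / l)\<rfloor>)"
  have x: "x \<in> grid_cell a l m v"
    using assms by (simp add: mem_grid_cell v_def)
  moreover have "grid_cell a l m v \<subseteq> ball x r"
  proof
    fix y assume y: "y \<in> grid_cell a l m v"
    have "\<bar>(x - y) $ i\<bar> \<le> l / 2 ^ m" for i
      using x y by (auto simp: grid_cell_def cube_def abs_le_iff dest!: spec[of _ i])
    then have "norm (x - y) \<le> (\<Sum>i\<in>(UNIV::'n set). l / 2 ^ m)"
      by (intro order_trans[OF norm_le_l1_cart] sum_mono) auto
    with m show "y \<in> ball x r"
      by (simp add: dist_norm)
  qed
  ultimately show ?thesis
    by (auto simp: grid_def)
qed

text \<open>Cover \<open>A\<close> by the cells that meet \<open>A\<close> and stay inside an open set \<open>U\<close> only slightly larger than \<open>A\<close>,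
  and compare on the maximal ones. Since \<open>M\<close> is bounded only on cells, and not on \<open>A\<close> itself, the error is
  measured by Lebesgue measure: it is at most \<open>c |U - A|\<close>.\<close>

lemma emeasure_le_of_cells:
  fixes M :: "(real ^ 'n) measure"
  assumes "l > 0" and sets: "sets M = sets lebesgue" and A: "A \<in> sets lebesgue" and "c \<ge> 0"
    and le: "\<And>P. P \<in> grid a l \<Longrightarrow> P \<inter> A \<noteq> {} \<Longrightarrow> emeasure M P \<le> ennreal c * emeasure lebesgue P"
  shows "emeasure M A \<le> ennreal c * emeasure lebesgue A"
proof (rule ennreal_le_epsilon)
  fix e :: real assume e: "e > 0"
  \<comment> \<open>The denominator is positive also when \<open>c = 0\<close>, and the final error \<open>c * (e / (c + 1))\<close> stays below \<open>e\<close>.\<close>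
  have "e / (c + 1) > 0"
    using e \<open>c \<ge> 0\<close> by simp
  then obtain U where U: "open U" "A \<subseteq> U" "emeasure lebesgue (U - A) < ennreal (e / (c + 1))"
    using sets_lebesgue_outer_open[OF A] by metis
  define F where "F = {P \<in> grid a l. P \<subseteq> U \<and> P \<inter> A \<noteq> {}}"
  have F: "F \<subseteq> grid a l" by (auto simp: F_def)
  have "A \<subseteq> \<Union>F"
  proof
    fix x assume x: "x \<in> A"
    then obtain r where "r > 0" "ball x r \<subseteq> U"
      using U by (meson open_contains_ball subsetD)
    with ex_grid_cell_in_ball[OF \<open>l > 0\<close>, of r a x] x show "x \<in> \<Union>F"
      unfolding F_def by blast
  qed
  then have "emeasure M A \<le> emeasure M (\<Union>F)"
    by (intro emeasure_mono) (auto simp: sets Union_grid_measurable[OF \<open>l > 0\<close> F])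
  also have "\<dots> \<le> ennreal c * emeasure lebesgue (\<Union>F)"
    by (rule emeasure_Union_le_of_maximals[OF \<open>l > 0\<close> F sets]) (auto simp: maximals_def F_def intro!: le)
  also have "\<dots> \<le> ennreal c * emeasure lebesgue (A \<union> (U - A))"
    using U A by (intro mult_left_mono emeasure_mono) (auto simp: F_def)
  also have "emeasure lebesgue (A \<union> (U - A)) = emeasure lebesgue A + emeasure lebesgue (U - A)"
    using U A by (intro plus_emeasure[symmetric]) auto
  also have "ennreal c * \<dots> \<le> ennreal c * (emeasure lebesgue A + ennreal (e / (c + 1)))"
    using U by (intro mult_left_mono add_left_mono) auto
  also have "\<dots> = ennreal c * emeasure lebesgue A + ennreal (c * (e / (c + 1)))"
    using \<open>c \<ge> 0\<close> e by (simp add: distrib_left ennreal_mult del: times_divide_eq_right)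
  also have "\<dots> \<le> ennreal c * emeasure lebesgue A + ennreal e"
    using \<open>c \<ge> 0\<close> e by (intro add_left_mono ennreal_leI) (simp add: field_simps)
  finally show "emeasure M A \<le> ennreal c * emeasure lebesgue A + ennreal e" .
qed

text \<open>This plays the part of the Lebesgue differentiation theorem: if the averages of \<open>h\<close> over all cells meeting
  \<open>G\<close> are at most \<open>c\<close>, then \<open>h \<le> c\<close> almost everywhere on \<open>G\<close>. On the set \<open>A\<close> where this fails,
  the previous lemma gives \<open>\<integral>\<^sub>A h \<le> c |A|\<close> although \<open>h > c\<close> there, so \<open>A\<close> is null.\<close>

lemma null_level_set_of_cell_averages:
  fixes h :: "real ^ 'n \<Rightarrow> ennreal"
  assumes "l > 0" and h[measurable]: "h \<in> borel_measurable lebesgue"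
    and G[measurable]: "G \<in> sets lebesgue" and fin: "emeasure lebesgue G < \<infinity>" and "c \<ge> 0"
    and le: "\<And>P. P \<in> grid a l \<Longrightarrow> P \<inter> G \<noteq> {} \<Longrightarrow>
        emeasure (density lebesgue h) P \<le> ennreal c * emeasure lebesgue P"
  shows "emeasure lebesgue {x \<in> G. ennreal c < h x} = 0"
proof -
  define A where "A = {x \<in> G. ennreal c < h x}"
  have "A = G \<inter> {x \<in> space lebesgue. ennreal c < h x}"
    by (auto simp: A_def)
  also have "\<dots> \<in> sets lebesgue"
    by measurable
  finally have A[measurable]: "A \<in> sets lebesgue" .
  have "emeasure lebesgue A \<le> emeasure lebesgue G"
    by (intro emeasure_mono) (auto simp: A_def)
  then have finA: "emeasure lebesgue A < \<infinity>"
    using fin by (rule le_less_trans)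
  have "emeasure (density lebesgue h) A \<le> ennreal c * emeasure lebesgue A"
    by (rule emeasure_le_of_cells[OF \<open>l > 0\<close> _ A \<open>c \<ge> 0\<close>]) (auto simp: A_def intro!: le)
  then have "(\<integral>\<^sup>+x. h x * indicator A x \<partial>lebesgue) \<le> (\<integral>\<^sup>+x. ennreal c * indicator A x \<partial>lebesgue)"
    by (simp add: emeasure_density nn_integral_cmult_indicator)
  moreover have "(\<integral>\<^sup>+x. ennreal c * indicator A x \<partial>lebesgue) < (\<integral>\<^sup>+x. h x * indicator A x \<partial>lebesgue)"
    if "\<not> (AE x in lebesgue. h x * indicator A x \<le> ennreal c * indicator A x)"
    using that finA
    by (intro nn_integral_less)
       (auto simp: nn_integral_cmult_indicator ennreal_mult_eq_top_iff A_def split: split_indicator)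
  ultimately have "AE x in lebesgue. h x * indicator A x \<le> ennreal c * indicator A x"
    by (meson not_le)
  then have "AE x in lebesgue. x \<notin> A"
    by (rule AE_mp) (auto simp: A_def not_less[symmetric])
  then show ?thesis
    using A by (simp add: AE_iff_measurable[OF _ refl] A_def)
qed

section \<open>The John--Nirenberg inequality\<close>

lemma L1_loc_integrable_cube:
  assumes "f \<in> L1_loc" "Q \<in> cubes"
  shows "set_integrable lebesgue Q f"
proof -
  obtain a l where Q: "Q = cube a l"
    using assms by (auto simp: cubes_def)
  have "set_integrable lebesgue (cbox a (a + (\<chi> i. l))) f"
    using assms by (simp add: L1_loc_def compact_cbox)
  then show ?thesis
    by (rule set_integrable_subset) (use Q cube_between(2) in auto)
qed

lemma L1_loc_integrable_cube_diff:
  assumes "f \<in> L1_loc" "Q \<in> cubes"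
  shows "set_integrable lebesgue Q (\<lambda>x. f x - c)"
proof -
  have "set_integrable lebesgue Q (\<lambda>x. c)"
    using cubes_lmeasurable(1)[OF assms(2)] by (simp add: set_integrable_def lmeasurable_iff_integrable)
  then show ?thesis
    using L1_loc_integrable_cube[OF assms] by (intro set_integral_diff)
qed

lemma emeasure_density_abs_diff:
  assumes f: "f \<in> L1_loc" and Q: "Q \<in> cubes"
  shows "emeasure (density lebesgue (\<lambda>x. ennreal \<bar>f x - c\<bar>)) Q
    = ennreal (average (\<lambda>x. \<bar>f x - c\<bar>) Q) * emeasure lebesgue Q"
proof -
  have [measurable]: "f \<in> borel_measurable lebesgue"
    using f by (simp add: L1_loc_def)
  have Qm [measurable]: "Q \<in> sets lebesgue" and Qp: "measure lebesgue Q > 0"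
    "emeasure lebesgue Q = ennreal (measure lebesgue Q)"
    using cubes_lmeasurable[OF Q] by (auto simp: emeasure_eq_measure2)
  have int: "set_integrable lebesgue Q (\<lambda>x. \<bar>f x - c\<bar>)"
    using L1_loc_integrable_cube_diff[OF f Q] by (rule set_integrable_abs)
  have "emeasure (density lebesgue (\<lambda>x. ennreal \<bar>f x - c\<bar>)) Q
      = (\<integral>\<^sup>+x. ennreal (indicator Q x *\<^sub>R \<bar>f x - c\<bar>) \<partial>lebesgue)"
    by (simp add: emeasure_density) (intro nn_integral_cong, simp split: split_indicator)
  also have "\<dots> = ennreal (LINT x:Q|lebesgue. \<bar>f x - c\<bar>)"
    using int unfolding set_integrable_def set_lebesgue_integral_def
    by (intro nn_integral_eq_integral) auto
  also have "(LINT x:Q|lebesgue. \<bar>f x - c\<bar>) = average (\<lambda>x. \<bar>f x - c\<bar>) Q * measure lebesgue Q"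
    using Qp by (simp add: average_def)
  finally show ?thesis
    using Qp(2) by (simp add: ennreal_mult'')
qed

lemma average_diff_le:
  assumes f: "f \<in> L1_loc" and Q: "Q \<in> cubes"
  shows "\<bar>average f Q - c\<bar> \<le> average (\<lambda>x. \<bar>f x - c\<bar>) Q"
proof -
  have Qm: "Q \<in> lmeasurable" and Qp: "measure lebesgue Q > 0"
    using cubes_lmeasurable[OF Q] by auto
  have "(LINT x:Q|lebesgue. f x - c) = (LINT x:Q|lebesgue. f x) - (LINT x:Q|lebesgue. c)"
    using Qm by (intro set_integral_diff L1_loc_integrable_cube[OF f Q])
      (simp add: set_integrable_def lmeasurable_iff_integrable)
  also have "(LINT x:Q|lebesgue. c) = c * measure lebesgue Q"
    using Qm by (simp add: set_lebesgue_integral_def)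
  finally have "average f Q - c = (LINT x:Q|lebesgue. f x - c) / measure lebesgue Q"
    using Qp by (simp add: average_def field_simps)
  moreover have "\<bar>LINT x:Q|lebesgue. f x - c\<bar> \<le> (LINT x:Q|lebesgue. \<bar>f x - c\<bar>)"
    using set_integral_norm_bound[OF L1_loc_integrable_cube_diff[OF f Q]] by simp
  ultimately show ?thesis
    using Qp by (simp add: average_def divide_right_mono)
qed

text \<open>Induction on \<open>k\<close>, simultaneously for all cubes. With \<open>c\<close> the average of \<open>f\<close> over \<open>Q\<close>, let \<open>F\<close> consist of the
  dyadic subcubes of \<open>Q\<close> over which the average of \<open>|f - c|\<close> exceeds \<open>2 * b\<close>. They
  fill at most half of \<open>Q\<close>, and outside them \<open>|f - c| \<le> 2 * b\<close> almost everywhere. The parent of a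
  maximal member \<open>R\<close> is not in \<open>F\<close>, so passing from the parent to \<open>R\<close> multiplies the average by at most
  \<open>2\<^sup>n\<close> and the average of \<open>f\<close> over \<open>R\<close> differs from \<open>c\<close> by at most \<open>M\<close>. Hence a deviation of more than
  \<open>(k + 1) M\<close> from \<open>c\<close> on \<open>R\<close> is one of more than \<open>k M\<close> from the average over \<open>R\<close>, and the induction
  hypothesis for \<open>R\<close> applies.\<close>

lemma John_Nirenberg:
  fixes f :: "real ^ 'n \<Rightarrow> real"
  assumes f: "f \<in> L1_loc" and b: "b > 0"
    and osc: "\<And>Q. Q \<in> cubes \<Longrightarrow> average (\<lambda>x. \<bar>f x - average f Q\<bar>) Q \<le> b"
    and "Q \<in> cubes"
  defines "M \<equiv> 2 ^ (CARD('n) + 1) * b"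
  shows "emeasure lebesgue {x \<in> Q. real k * M < \<bar>f x - average f Q\<bar>} \<le> ennreal ((1 / 2) ^ k) * emeasure lebesgue Q"
  using \<open>Q \<in> cubes\<close>
proof (induction k arbitrary: Q)
  case 0
  then have "emeasure lebesgue {x \<in> Q. real 0 * M < \<bar>f x - average f Q\<bar>} \<le> emeasure lebesgue Q"
    using cubes_lmeasurable(1)[OF 0] by (intro emeasure_mono) auto
  then show ?case by simp
next
  case (Suc k)
  obtain a l where l: "l > 0" and Q: "Q = cube a l"
    using Suc.prems by (auto simp: cubes_def)
  have [measurable]: "f \<in> borel_measurable lebesgue"
    using f by (simp add: L1_loc_def)
  have cells: "P \<in> cubes" "P \<in> sets lebesgue" if "P \<in> grid a l" for P
    using that grid_subset_cubes[OF l] grid_measurable[OF l] by auto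
  have Qm [measurable]: "Q \<in> sets lebesgue" and Qfin: "emeasure lebesgue Q < \<infinity>"
    using cubes_lmeasurable(1)[OF Suc.prems] by (auto simp: fmeasurable_def)
  define c where "c = average f Q"
  define \<nu> where "\<nu> = density lebesgue (\<lambda>x. ennreal \<bar>f x - c\<bar>)"
  have [simp]: "sets \<nu> = sets lebesgue"
    by (simp add: \<nu>_def)
  have \<nu>: "emeasure \<nu> P = ennreal (average (\<lambda>x. \<bar>f x - c\<bar>) P) * emeasure lebesgue P" if "P \<in> cubes" for P
    unfolding \<nu>_def by (rule emeasure_density_abs_diff[OF f that])
  have \<nu>Q: "emeasure \<nu> Q \<le> ennreal b * emeasure lebesgue Q"
    using \<nu>[OF Suc.prems] osc[OF Suc.prems] by (simp add: c_def mult_right_mono ennreal_leI)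
  define F where "F = {P \<in> grid a l. P \<subseteq> Q \<and> \<not> emeasure \<nu> P \<le> ennreal (2 * b) * emeasure lebesgue P}"
  have F: "F \<subseteq> grid a l" "\<Union>F \<subseteq> Q"
    by (auto simp: F_def)
  note UF [measurable] = Union_grid_measurable[OF l F(1)]
  define L where "L = {x \<in> Q. real (Suc k) * M < \<bar>f x - c\<bar>}"
  have "L = Q \<inter> {x \<in> space lebesgue. real (Suc k) * M < \<bar>f x - c\<bar>}"
    by (auto simp: L_def)
  also have "\<dots> \<in> sets lebesgue"
    by measurable
  finally have Lm [measurable]: "L \<in> sets lebesgue" .
  have M: "2 * b \<le> M" "0 < M"
    using b by (auto simp: M_def)
  \<comment> \<open>Since \<open>Q\<close> itself is not in \<open>F\<close>, a maximal member of \<open>F\<close> has a parent inside \<open>Q\<close>.\<close>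
  have avg_R: "\<bar>average f R - c\<bar> \<le> M" if R: "R \<in> maximals F" for R
  proof -
    have R': "R \<in> grid a l" "R \<subseteq> Q" "\<not> emeasure \<nu> R \<le> ennreal (2 * b) * emeasure lebesgue R"
      using R by (auto simp: maximals_def F_def)
    have "ennreal b * emeasure lebesgue Q \<le> ennreal (2 * b) * emeasure lebesgue Q"
      using b by (intro mult_right_mono ennreal_leI) auto
    then have "R \<noteq> Q"
      using \<nu>Q R'(3) by (meson order_trans)
    then obtain P where P: "P \<in> grid a l" "R \<subset> P" "P \<subseteq> Q" "emeasure lebesgue P = 2 ^ CARD('n) * emeasure lebesgue R"
      using grid_parent[OF l R'(1)] R'(2) Q by auto
    then have "P \<notin> F"
      using R by (auto simp: maximals_def)
    then have \<nu>P: "emeasure \<nu> P \<le> ennreal (2 * b) * emeasure lebesgue P"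
      using P by (auto simp: F_def)
    have "ennreal (average (\<lambda>x. \<bar>f x - c\<bar>) R) * emeasure lebesgue R = emeasure \<nu> R"
      using \<nu> cells R' by simp
    also have "\<dots> \<le> emeasure \<nu> P"
      using P cells by (intro emeasure_mono) auto
    also have "\<dots> \<le> ennreal (2 * b) * (ennreal (2 ^ CARD('n)) * emeasure lebesgue R)"
      using \<nu>P by (simp add: P flip: ennreal_power)
    also have "\<dots> = ennreal M * emeasure lebesgue R"
      using b by (simp add: M_def ennreal_mult mult_ac)
    finally have "average (\<lambda>x. \<bar>f x - c\<bar>) R * measure lebesgue R \<le> M * measure lebesgue R"
      using cubes_lmeasurable[OF cells(1)[OF R'(1)]] M
      by (simp add: emeasure_eq_measure2 flip: ennreal_mult'')
    then have "average (\<lambda>x. \<bar>f x - c\<bar>) R \<le> M"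
      using cubes_lmeasurable(2)[OF cells(1)[OF R'(1)]] by simp
    then show ?thesis
      using average_diff_le[OF f cells(1)[OF R'(1)], of c] by simp
  qed
  define B where "B = {x \<in> Q - \<Union>F. ennreal (2 * b) < ennreal \<bar>f x - c\<bar>}"
  have "B = (Q - \<Union>F) \<inter> {x \<in> space lebesgue. ennreal (2 * b) < ennreal \<bar>f x - c\<bar>}"
    by (auto simp: B_def)
  also have "\<dots> \<in> sets lebesgue"
    by measurable
  finally have Bm: "B \<in> sets lebesgue" .
  \<comment> \<open>A cell meeting \<open>Q - \<Union>F\<close> lies in \<open>Q\<close> but not in \<open>F\<close>, so its average is at most \<open>2 * b\<close>.\<close>
  have "emeasure lebesgue B = 0"
    unfolding B_def
  proof (rule null_level_set_of_cell_averages[OF l])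
    show "emeasure lebesgue (Q - \<Union>F) < \<infinity>"
      by (rule le_less_trans[OF emeasure_mono Qfin]) auto
    fix P assume P: "P \<in> grid a l" "P \<inter> (Q - \<Union>F) \<noteq> {}"
    then have "P \<subseteq> Q" "P \<notin> F"
      using grid_subset_cube[OF l P(1)] by (auto simp: Q)
    with P show "emeasure (density lebesgue (\<lambda>x. ennreal \<bar>f x - c\<bar>)) P \<le> ennreal (2 * b) * emeasure lebesgue P"
      by (auto simp: F_def \<nu>_def)
  qed (use b in auto)
  moreover have "L - \<Union>F \<subseteq> B"
  proof -
    have "2 * b \<le> real (Suc k) * M"
      using M by (simp add: distrib_right add_increasing2)
    then show ?thesis
      using b by (auto simp: L_def B_def ennreal_less_iff)
  qed
  ultimately have "emeasure lebesgue (L - \<Union>F) = 0"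
    using Bm by (metis emeasure_eq_0)
  moreover have "emeasure lebesgue L \<le> emeasure lebesgue (L \<inter> \<Union>F) + emeasure lebesgue (L - \<Union>F)"
    using emeasure_subadditive[of "L \<inter> \<Union>F" lebesgue "L - \<Union>F"] by (simp add: Int_Diff_Un)
  ultimately have "emeasure lebesgue L \<le> emeasure lebesgue (L \<inter> \<Union>F)"
    by simp
  also have "\<dots> \<le> ennreal ((1 / 2) ^ k) * emeasure lebesgue (\<Union>F)"
  proof -
    define \<mu> where "\<mu> = density lebesgue (indicator L)"
    have \<mu>: "emeasure \<mu> A = emeasure lebesgue (L \<inter> A)" if "A \<in> sets lebesgue" for A
      using that by (simp add: \<mu>_def emeasure_density indicator_inter_arith[symmetric])
    have "emeasure \<mu> (\<Union>F) \<le> ennreal ((1 / 2) ^ k) * emeasure lebesgue (\<Union>F)"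
    proof (rule emeasure_Union_le_of_maximals[OF l F(1)])
      fix R assume R: "R \<in> maximals F"
      then have R': "R \<in> grid a l"
        using F by (auto simp: maximals_def)
      define L' where "L' = {x \<in> R. real k * M < \<bar>f x - average f R\<bar>}"
      have "L' = R \<inter> {x \<in> space lebesgue. real k * M < \<bar>f x - average f R\<bar>}"
        by (auto simp: L'_def)
      also have "\<dots> \<in> sets lebesgue"
        using cells(2)[OF R'] by measurable
      finally have "L' \<in> sets lebesgue" .
      moreover have "L \<inter> R \<subseteq> L'"
        using avg_R[OF R] by (auto simp: L_def L'_def algebra_simps)
      ultimately have "emeasure \<mu> R \<le> emeasure lebesgue L'"
        unfolding \<mu>[OF cells(2)[OF R']] by (intro emeasure_mono)
      also have "\<dots> \<le> ennreal ((1 / 2) ^ k) * emeasure lebesgue R"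
        unfolding L'_def by (rule Suc.IH[OF cells(1)[OF R']])
      finally show "emeasure \<mu> R \<le> ennreal ((1 / 2) ^ k) * emeasure lebesgue R" .
    qed (simp_all add: \<mu>_def)
    then show ?thesis
      by (simp add: \<mu>)
  qed
  finally have "emeasure lebesgue L \<le> ennreal ((1 / 2) ^ k) * emeasure lebesgue (\<Union>F)" .
  moreover have "emeasure lebesgue (\<Union>F) \<le> ennreal (1 / 2) * emeasure lebesgue Q"
  proof -
    have *: "ennreal (1 / (2 * b)) * (ennreal (2 * b) * y) = y" for y
      using b by (simp flip: mult.assoc ennreal_mult)
    have "emeasure lebesgue (\<Union>F) \<le> ennreal (1 / (2 * b)) * emeasure \<nu> (\<Union>F)"
    proof (rule emeasure_Union_le_of_maximals[OF l F(1)])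
      fix R assume "R \<in> maximals F"
      then have "ennreal (2 * b) * emeasure lebesgue R \<le> emeasure \<nu> R"
        by (auto simp: maximals_def F_def)
      then have "ennreal (1 / (2 * b)) * (ennreal (2 * b) * emeasure lebesgue R) \<le> ennreal (1 / (2 * b)) * emeasure \<nu> R"
        by (rule mult_left_mono) simp
      then show "emeasure lebesgue R \<le> ennreal (1 / (2 * b)) * emeasure \<nu> R"
        unfolding * .
    qed simp_all
    also have "\<dots> \<le> ennreal (1 / (2 * b)) * (ennreal b * emeasure lebesgue Q)"
      using F by (intro mult_left_mono order_trans[OF emeasure_mono \<nu>Q]) auto
    also have "\<dots> = ennreal (1 / 2) * emeasure lebesgue Q"
      using b by (simp flip: mult.assoc ennreal_mult)
    finally show ?thesis .
  qed
  ultimately have "emeasure lebesgue L \<le> ennreal ((1 / 2) ^ k) * (ennreal (1 / 2) * emeasure lebesgue Q)"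
    by (meson mult_left_mono order_trans zero_le)
  also have "\<dots> = ennreal ((1 / 2) ^ Suc k) * emeasure lebesgue Q"
  proof -
    have "ennreal ((1 / 2) ^ Suc k) = ennreal ((1 / 2) ^ k) * ennreal (1 / 2)"
      by (subst ennreal_mult[symmetric]) (auto simp: mult.commute)
    then show ?thesis by (simp only: mult.assoc)
  qed
  finally have "emeasure lebesgue L \<le> ennreal ((1 / 2) ^ Suc k) * emeasure lebesgue Q" .
  then show ?case
    by (simp add: L_def c_def)
qed

section \<open>Overlaps of a sparse family\<close>

lemma nn_integral_count_space_le_infsum:
  fixes f :: "'a \<Rightarrow> ennreal"
  assumes "countable A"
  shows "(\<integral>\<^sup>+x. f x \<partial>count_space A) \<le> infsum f A"
proof (cases "finite A")
  case True
  then show ?thesis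
    by (simp add: nn_integral_count_space_finite)
next
  case False
  define e where "e = from_nat_into A"
  have e: "bij_betw e UNIV A"
    unfolding e_def by (rule bij_betw_from_nat_into[OF assms False])
  have "(\<integral>\<^sup>+x. f x \<partial>count_space A) = (\<Sum>n. f (e n))"
    by (simp add: nn_integral_count_space_nat flip: nn_integral_bij_count_space[OF e])
  also have "\<dots> = (SUP n. \<Sum>i<n. f (e i))"
    by (rule suminf_eq_SUP)
  also have "\<dots> \<le> infsum f A"
  proof (rule SUP_least)
    fix n :: nat
    have "(\<Sum>i<n. f (e i)) = sum f (e ` {..<n})"
      using e by (intro sum.reindex_cong[symmetric, of e]) (auto simp: bij_betw_def intro: inj_on_subset)
    also have "\<dots> \<le> infsum f A"
      using e by (subst nonneg_infsum_complete) (auto simp: bij_betw_def intro!: SUP_upper)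
    finally show "(\<Sum>i<n. f (e i)) \<le> infsum f A" .
  qed
  finally show ?thesis .
qed

text \<open>The points that belong to more than \<open>k\<close> members of \<open>F\<close>, described by finite subfamilies so that points
  in infinitely many members are included and measurability is evident for countable \<open>F\<close>.\<close>

definition overlap :: "'a set set \<Rightarrow> nat \<Rightarrow> 'a set" where
  "overlap F k = \<Union>(Inter ` {T. finite T \<and> T \<subseteq> F \<and> card T = Suc k})"

lemma mem_overlap: "x \<in> overlap F k \<longleftrightarrow> (\<exists>T. finite T \<and> T \<subseteq> F \<and> card T = Suc k \<and> (\<forall>R\<in>T. x \<in> R))"
  by (auto simp: overlap_def)

lemma overlap_subset: "overlap F k \<subseteq> \<Union>F"
proof
  fix x assume "x \<in> overlap F k"
  then obtain T where T: "finite T" "T \<subseteq> F" "card T = Suc k" "\<forall>R\<in>T. x \<in> R"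
    unfolding mem_overlap by (elim exE conjE) (rule that)
  then have "T \<noteq> {}" by auto
  with T show "x \<in> \<Union>F" by auto
qed

lemma overlap_measurable:
  assumes "l > 0" "F \<subseteq> grid a l"
  shows "overlap F k \<in> sets lebesgue"
  unfolding overlap_def
proof (rule sets.countable_Union)
  have "countable F"
    using assms(2) countable_grid by (rule countable_subset)
  then have "countable {T. finite T \<and> T \<subseteq> F}"
    by (rule countable_Collect_finite_subset)
  then have "countable {T. finite T \<and> T \<subseteq> F \<and> card T = Suc k}"
    by (rule countable_subset[rotated]) auto
  then show "countable (Inter ` {T. finite T \<and> T \<subseteq> F \<and> card T = Suc k})"
    by simp
  show "Inter ` {T. finite T \<and> T \<subseteq> F \<and> card T = Suc k} \<subseteq> sets lebesgue"
  proof clarify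
    fix T assume T: "finite T" "T \<subseteq> F" "card T = Suc k"
    then have "T \<noteq> {}" by auto
    then have "(\<Inter>R\<in>T. R) \<in> sets lebesgue"
      using T assms grid_measurable[OF assms(1), of _ a] by (intro sets.finite_INT) auto
    then show "\<Inter>T \<in> sets lebesgue" by simp
  qed
qed

text \<open>A point lies in at most one maximal cell, so every member of \<open>F\<close> containing it is contained in that
  cell.\<close>

lemma overlap_localize:
  assumes "l > 0" "F \<subseteq> grid a l" "R \<in> maximals F" "x \<in> overlap F k" "x \<in> R"
  shows "x \<in> overlap {R' \<in> F. R' \<subseteq> R} k"
proof -
  obtain T where T: "finite T" "T \<subseteq> F" "card T = Suc k" "\<forall>R\<in>T. x \<in> R"
    using assms(4) unfolding mem_overlap by (elim exE conjE) (rule that)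
  have "R' \<subseteq> R" if "R' \<in> T" for R'
  proof -
    have "R' \<in> F" "x \<in> R'"
      using T that by auto
    then obtain R'' where R'': "R'' \<in> maximals F" "R' \<subseteq> R''"
      using ex_maximals_superset[OF assms(1,2)] by metis
    then have "x \<in> R \<inter> R''"
      using assms(5) \<open>x \<in> R'\<close> by auto
    then have "R'' = R"
      using maximals_disjoint[OF assms(1,2)] assms(3) R''(1) unfolding disjoint_family_on_def by (metis empty_iff)
    with R'' show ?thesis by simp
  qed
  with T show ?thesis
    unfolding mem_overlap by (intro exI[of _ T]) auto
qed

lemma emeasure_overlap_le_of_maximals:
  assumes "l > 0" "F \<subseteq> grid a l"
    and le: "\<And>R. R \<in> maximals F \<Longrightarrow> emeasure lebesgue (overlap {R' \<in> F. R' \<subseteq> R} k) \<le> c * emeasure lebesgue R"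
  shows "emeasure lebesgue (overlap F k) \<le> c * emeasure lebesgue (\<Union>F)"
proof -
  have O: "overlap F k \<in> sets lebesgue"
    by (rule overlap_measurable[OF assms(1,2)])
  define M where "M = density lebesgue (indicator (overlap F k))"
  have M: "emeasure M A = emeasure lebesgue (overlap F k \<inter> A)" if "A \<in> sets lebesgue" for A
    using that O by (simp add: M_def emeasure_density indicator_inter_arith[symmetric])
  have "emeasure M (\<Union>F) \<le> c * emeasure lebesgue (\<Union>F)"
  proof (rule emeasure_Union_le_of_maximals[OF assms(1,2)])
    fix R assume R: "R \<in> maximals F"
    then have Rs: "R \<in> sets lebesgue"
      using assms grid_measurable[OF assms(1)] by (auto simp: maximals_def)
    have "emeasure M R \<le> emeasure lebesgue (overlap {R' \<in> F. R' \<subseteq> R} k)"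
      unfolding M[OF Rs] using overlap_localize[OF assms(1,2) R] assms(2)
      by (intro emeasure_mono overlap_measurable[OF assms(1), of _ a]) auto
    then show "emeasure M R \<le> c * emeasure lebesgue R"
      using le[OF R] by (rule order_trans)
  qed (simp_all add: M_def)
  then show ?thesis
    using overlap_subset[of F k] by (simp add: M Union_grid_measurable[OF assms(1,2)] Int_absorb2)
qed

lemma overlap_Suc_subset: "overlap {R \<in> S. R \<subseteq> P} (Suc k) \<subseteq> overlap {R \<in> S. R \<subset> P} k"
proof
  fix x assume "x \<in> overlap {R \<in> S. R \<subseteq> P} (Suc k)"
  then obtain T where T: "finite T" "T \<subseteq> {R \<in> S. R \<subseteq> P}" "card T = Suc (Suc k)" "\<forall>R\<in>T. x \<in> R"
    unfolding mem_overlap by (elim exE conjE) (rule that)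
  have "Suc k \<le> card (T - {P})"
    using T by (simp add: card_Diff_singleton_if)
  then obtain T' where "T' \<subseteq> T - {P}" "card T' = Suc k" "finite T'"
    by (rule obtain_subset_with_card_n)
  with T show "x \<in> overlap {R \<in> S. R \<subset> P} k"
    unfolding mem_overlap by (intro exI[of _ T']) auto
qed

lemma emeasure_Union_proper_subcubes_le:
  assumes "l > 0" "S \<subseteq> grid a l" "sparse \<eta> S" "P \<in> S"
  shows "emeasure lebesgue (\<Union>{R \<in> S. R \<subset> P}) \<le> ennreal (1 - \<eta>) * emeasure lebesgue P"
proof -
  have F: "{R \<in> S. R \<subset> P} \<subseteq> grid a l"
    using assms by auto
  have "emeasure lebesgue (\<Union>{R \<in> S. R \<subset> P}) = (\<integral>\<^sup>+R. emeasure lebesgue R \<partial>count_space (children S P))"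
    by (simp add: emeasure_Union_maximals[OF assms(1) F] children_eq_maximals)
  also have "\<dots> \<le> (\<Sum>\<^sub>\<infinity>R \<in> children S P. emeasure lebesgue R)"
    using assms by (intro nn_integral_count_space_le_infsum countable_subset[OF _ countable_grid[of a l]])
      (auto simp: children_def)
  also have "\<dots> \<le> ennreal (1 - \<eta>) * emeasure lebesgue P"
    using assms by (simp add: sparse_def)
  finally show ?thesis .
qed

text \<open>Each step discards \<open>P\<close> itself from the count, which localizes the rest to the children of \<open>P\<close>; these
  cover at most the fraction \<open>1 - \<eta>\<close> of \<open>P\<close>.\<close>

lemma sparse_overlap_decay:
  assumes l: "l > 0" and S: "S \<subseteq> grid a l" and sp: "sparse \<eta> S" and \<eta>: "0 < \<eta>" "\<eta> < 1" and "P \<in> S"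
  shows "emeasure lebesgue (overlap {R \<in> S. R \<subseteq> P} k) \<le> ennreal ((1 - \<eta>) ^ k) * emeasure lebesgue P"
  using \<open>P \<in> S\<close>
proof (induction k arbitrary: P)
  case 0
  have "P \<in> sets lebesgue"
    using 0 S grid_measurable[OF l] by auto
  then have "emeasure lebesgue (overlap {R \<in> S. R \<subseteq> P} 0) \<le> emeasure lebesgue P"
    using overlap_subset[of "{R \<in> S. R \<subseteq> P}" 0] by (intro emeasure_mono) auto
  then show ?case by simp
next
  case (Suc k)
  define F where "F = {R \<in> S. R \<subset> P}"
  have F: "F \<subseteq> grid a l"
    using S by (auto simp: F_def)
  have "emeasure lebesgue (overlap {R \<in> S. R \<subseteq> P} (Suc k)) \<le> emeasure lebesgue (overlap F k)"
    unfolding F_def by (intro emeasure_mono overlap_Suc_subset overlap_measurable[OF l, of _ a]) (use S in auto)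
  also have "\<dots> \<le> ennreal ((1 - \<eta>) ^ k) * emeasure lebesgue (\<Union>F)"
  proof (rule emeasure_overlap_le_of_maximals[OF l F])
    fix R assume "R \<in> maximals F"
    then have R: "R \<in> S" "R \<subset> P"
      by (auto simp: maximals_def F_def)
    then have "{R' \<in> F. R' \<subseteq> R} = {R' \<in> S. R' \<subseteq> R}"
      by (auto simp: F_def)
    then show "emeasure lebesgue (overlap {R' \<in> F. R' \<subseteq> R} k) \<le> ennreal ((1 - \<eta>) ^ k) * emeasure lebesgue R"
      using Suc.IH[OF R(1)] by simp
  qed
  also have "\<dots> \<le> ennreal ((1 - \<eta>) ^ k) * (ennreal (1 - \<eta>) * emeasure lebesgue P)"
    unfolding F_def by (intro mult_left_mono emeasure_Union_proper_subcubes_le[OF l S sp Suc.prems]) simp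
  also have "\<dots> = ennreal ((1 - \<eta>) ^ Suc k) * emeasure lebesgue P"
    using \<eta> by (simp add: ennreal_mult mult_ac)
  finally show ?case .
qed

text \<open>The sum exceeds \<open>k\<close> exactly on the overlap set of \<open>S\<close>. The cube \<open>Q\<close> need not belong to \<open>S\<close>, so the decay is
  applied to the maximal members of \<open>S\<close>, which are disjoint subsets of \<open>Q\<close>.\<close>

lemma sparse_sum_decay:
  fixes S :: "(real ^ 'n) set set"
  assumes Q: "Q \<in> cubes" and S: "S \<subseteq> dyadic Q" and sp: "sparse \<eta> S" and \<eta>: "0 < \<eta>" "\<eta> < 1"
  defines "F \<equiv> \<lambda>x. \<Sum>\<^sub>\<infinity>P \<in> S. indicator P x :: ennreal"
  shows "F \<in> borel_measurable lebesgue"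
    and "emeasure lebesgue {x \<in> Q. of_nat k < F x} \<le> ennreal ((1 - \<eta>) ^ k) * emeasure lebesgue Q"
proof -
  obtain a l where l: "l > 0" and Q_eq: "Q = cube a l"
    using Q by (auto simp: cubes_def)
  have S': "S \<subseteq> grid a l" "\<Union>S \<subseteq> Q"
    using dyadic_subset_grid[OF l, of _ a] S unfolding Q_eq by blast+
  have F: "F = (\<lambda>x. SUP T\<in>{T. finite T \<and> T \<subseteq> S}. \<Sum>P\<in>T. indicator P x)"
    unfolding F_def by (intro ext nonneg_infsum_complete) simp
  have "countable {T. finite T \<and> T \<subseteq> S}"
    using S'(1) countable_grid by (intro countable_Collect_finite_subset) (rule countable_subset)
  then show "F \<in> borel_measurable lebesgue"
    unfolding F using S'(1) grid_measurable[OF l, of _ a]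
    by (intro borel_measurable_SUP borel_measurable_sum borel_measurable_indicator) auto
  have Qm: "Q \<in> sets lebesgue"
    using cubes_lmeasurable(1)[OF Q] by auto
  have "{x \<in> Q. of_nat k < F x} \<subseteq> overlap S k"
  proof clarify
    fix x assume "of_nat k < F x"
    then obtain T where T: "finite T" "T \<subseteq> S" "of_nat k < (\<Sum>P\<in>T. indicator P x :: ennreal)"
      by (auto simp: F less_SUP_iff)
    have "(\<Sum>P\<in>T. indicator P x :: ennreal) = of_nat (card {P \<in> T. x \<in> P})"
      using T(1) by (simp add: indicator_def sum.If_cases Int_def)
    then have "Suc k \<le> card {P \<in> T. x \<in> P}"
      using T(3) by simp
    then obtain T' where "T' \<subseteq> {P \<in> T. x \<in> P}" "card T' = Suc k" "finite T'"
      by (rule obtain_subset_with_card_n)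
    with T show "x \<in> overlap S k"
      unfolding mem_overlap by (intro exI[of _ T']) auto
  qed
  then have "emeasure lebesgue {x \<in> Q. of_nat k < F x} \<le> emeasure lebesgue (overlap S k)"
    by (intro emeasure_mono overlap_measurable[OF l S'(1)])
  also have "\<dots> \<le> ennreal ((1 - \<eta>) ^ k) * emeasure lebesgue (\<Union>S)"
    by (rule emeasure_overlap_le_of_maximals[OF l S'(1)])
       (auto simp: maximals_def intro!: sparse_overlap_decay[OF l S'(1) sp \<eta>])
  also have "\<dots> \<le> ennreal ((1 - \<eta>) ^ k) * emeasure lebesgue Q"
    by (intro mult_left_mono emeasure_mono S' Qm) simp
  finally show "emeasure lebesgue {x \<in> Q. of_nat k < F x} \<le> ennreal ((1 - \<eta>) ^ k) * emeasure lebesgue Q" .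
qed

section \<open>Quasi-norms controlled by level sets\<close>

lemma quasi_banach_function_spaceD:
  assumes "quasi_banach_function_space M X N"
  shows "f \<in> X \<Longrightarrow> f \<in> borel_measurable M"
    and "(\<lambda>x. 0) \<in> X"
    and "f \<in> X \<Longrightarrow> g \<in> X \<Longrightarrow> (\<lambda>x. f x + g x) \<in> X"
    and "f \<in> X \<Longrightarrow> (\<lambda>x. c * f x) \<in> X"
    and "f \<in> X \<Longrightarrow> N (\<lambda>x. c * f x) = \<bar>c\<bar> * N f"
    and "f \<in> X \<Longrightarrow> 0 \<le> N f"
    and "f \<in> borel_measurable M \<Longrightarrow> g \<in> X \<Longrightarrow> AE x in M. \<bar>f x\<bar> \<le> \<bar>g x\<bar> \<Longrightarrow> f \<in> X"
    and "f \<in> borel_measurable M \<Longrightarrow> g \<in> X \<Longrightarrow> AE x in M. \<bar>f x\<bar> \<le> \<bar>g x\<bar> \<Longrightarrow> N f \<le> N g"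
proof -
  note q = assms[unfolded quasi_banach_function_space_def]
  show "f \<in> X \<Longrightarrow> f \<in> borel_measurable M"
    using conjunct1[OF q] by (rule subsetD)
  show "(\<lambda>x. 0) \<in> X"
    using q by (elim conjE)
  have *: "\<forall>f\<in>X. \<forall>g\<in>X. (\<lambda>x. f x + g x) \<in> X"
    using q by (elim conjE)
  show "f \<in> X \<Longrightarrow> g \<in> X \<Longrightarrow> (\<lambda>x. f x + g x) \<in> X"
    by (rule *[rule_format])
  have *: "\<forall>f\<in>X. \<forall>c. (\<lambda>x. c * f x) \<in> X \<and> N (\<lambda>x. c * f x) = \<bar>c\<bar> * N f"
    using q by (elim conjE)
  show "f \<in> X \<Longrightarrow> (\<lambda>x. c * f x) \<in> X" "f \<in> X \<Longrightarrow> N (\<lambda>x. c * f x) = \<bar>c\<bar> * N f"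
    using *[rule_format, of f c] by simp_all
  have *: "\<forall>f\<in>X. 0 \<le> N f \<and> (N f = 0 \<longleftrightarrow> (AE x in M. f x = 0))"
    using q by (elim conjE)
  show "f \<in> X \<Longrightarrow> 0 \<le> N f"
    using *[rule_format, of f] by simp
  have *: "\<forall>f\<in>borel_measurable M. \<forall>g\<in>X. (AE x in M. \<bar>f x\<bar> \<le> \<bar>g x\<bar>) \<longrightarrow> f \<in> X \<and> N f \<le> N g"
    using q by (elim conjE)
  show "f \<in> borel_measurable M \<Longrightarrow> g \<in> X \<Longrightarrow> AE x in M. \<bar>f x\<bar> \<le> \<bar>g x\<bar> \<Longrightarrow> f \<in> X"
    "f \<in> borel_measurable M \<Longrightarrow> g \<in> X \<Longrightarrow> AE x in M. \<bar>f x\<bar> \<le> \<bar>g x\<bar> \<Longrightarrow> N f \<le> N g"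
    using *[rule_format, of f g] by simp_all
qed

text \<open>Stated with an upper bound in place of the supremum, so that boundedness of the sequence of quasi-norms
  is implied.\<close>

lemma quasi_banach_function_space_Fatou:
  fixes M :: "'a measure"
  assumes "quasi_banach_function_space M X N" "f \<in> borel_measurable M" "\<And>j. F j \<in> X"
    and "AE x in M. (\<forall>j. 0 \<le> F j x) \<and> incseq (\<lambda>j. F j x) \<and> (\<lambda>j. F j x) \<longlonglongrightarrow> f x"
    and le: "\<And>j::nat. N (F j) \<le> B"
  shows "f \<in> X \<and> N f \<le> B"
proof -
  have "bdd_above (range (\<lambda>j. N (F j)))"
    using le by (auto intro: bdd_aboveI[of _ B])
  then have seq: "(\<forall>j. F j \<in> X) \<and>
      (AE x in M. (\<forall>j. 0 \<le> F j x) \<and> incseq (\<lambda>j. F j x) \<and> (\<lambda>j. F j x) \<longlonglongrightarrow> f x) \<and>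
      bdd_above (range (\<lambda>j. N (F j)))"
    using assms(3,4) by simp
  have H: "\<forall>f\<in>borel_measurable M. \<forall>F :: nat \<Rightarrow> 'a \<Rightarrow> real.
        (\<forall>j. F j \<in> X) \<and>
        (AE x in M. (\<forall>j. 0 \<le> F j x) \<and> incseq (\<lambda>j. F j x) \<and> (\<lambda>j. F j x) \<longlonglongrightarrow> f x) \<and>
        bdd_above (range (\<lambda>j. N (F j)))
        \<longrightarrow> f \<in> X \<and> N f = (SUP j. N (F j))"
    using assms(1) unfolding quasi_banach_function_space_def by (elim conjE)
  have "f \<in> X \<and> N f = (SUP j. N (F j))"
    using H[THEN bspec, OF assms(2), THEN spec, of F] seq by (rule mp)
  moreover have "(SUP j. N (F j)) \<le> B"
    by (intro cSUP_least le) auto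
  ultimately show ?thesis by simp
qed

lemma quasi_banach_function_space_sum:
  assumes "quasi_banach_function_space M X N" "finite J" "\<And>j. j \<in> J \<Longrightarrow> h j \<in> X"
  shows "(\<lambda>x. \<Sum>j\<in>J. h j x) \<in> X"
  using assms(2,3)
  by (induction J rule: finite_induct)
     (auto intro: quasi_banach_function_spaceD(2,3)[OF assms(1)])

text \<open>The pointwise inequality behind the level set decomposition: the integers \<open>0, \<dots>, m - 1\<close> below \<open>y\<close> number at
  least \<open>min y m\<close>.\<close>

lemma min_of_nat_le_count:
  fixes y :: real
  shows "min y (real m) \<le> (\<Sum>j=1..m. if real (j - 1) < y then 1 else 0)"
  by (induction m) (auto simp: min_def split: if_splits)

text \<open>The truncation of \<open>|g|\<close> at height \<open>m\<close> is at most the sum of the indicators of the first \<open>m\<close> level sets, to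
  which the \<open>\<rho>\<close>-triangle inequality applies; the truncations increase to \<open>|g|\<close>, so the Fatou
  property carries the bound over.\<close>

lemma norm_le_of_level_sets:
  assumes q: "quasi_banach_function_space M X N" and "\<rho> > 0" "C \<ge> 0"
    and tri: "\<And>(h :: nat \<Rightarrow> 'a \<Rightarrow> real) m. (\<And>j. j \<in> {1..m} \<Longrightarrow> h j \<in> X) \<Longrightarrow>
        N (\<lambda>x. \<Sum>j=1..m. h j x) powr \<rho> \<le> C * (\<Sum>j=1..m. N (h j) powr \<rho>)"
    and g: "g \<in> borel_measurable M"
    and E: "\<And>k::nat. E k = {x \<in> space M. real k < \<bar>g x\<bar>}" "\<And>k. indicator (E k) \<in> X"
    and K: "\<And>m. (\<Sum>k<m. N (indicator (E k)) powr \<rho>) \<le> K"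
  shows "g \<in> X \<and> N g \<le> (C * K) powr (1 / \<rho>)"
proof -
  note X = quasi_banach_function_spaceD[OF q]
  define F where "F m x = min \<bar>g x\<bar> (real m)" for m :: nat and x
  define G :: "nat \<Rightarrow> 'a \<Rightarrow> real" where "G m x = (\<Sum>j=1..m. indicator (E (j - 1)) x)" for m x
  have GX: "G m \<in> X" for m
    unfolding G_def by (intro quasi_banach_function_space_sum[OF q] E) auto
  have "N (G m) powr \<rho> \<le> C * K" for m
  proof -
    have "N (G m) powr \<rho> \<le> C * (\<Sum>j=1..m. N (indicator (E (j - 1))) powr \<rho>)"
      unfolding G_def by (intro tri E)
    also have "(\<Sum>j=1..m. N (indicator (E (j - 1))) powr \<rho>) = (\<Sum>k<m. N (indicator (E k)) powr \<rho>)"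
      by (rule sum.reindex_bij_witness[of _ Suc "\<lambda>j. j - 1"]) auto
    finally show ?thesis
      using K[of m] \<open>C \<ge> 0\<close> by (meson mult_left_mono order_trans)
  qed
  then have "(N (G m) powr \<rho>) powr (1 / \<rho>) \<le> (C * K) powr (1 / \<rho>)" for m
    using \<open>\<rho> > 0\<close> by (intro powr_mono2) auto
  then have NG: "N (G m) \<le> (C * K) powr (1 / \<rho>)" for m
    using \<open>\<rho> > 0\<close> by (auto simp: powr_powr intro: order_trans[OF abs_ge_self])
  have Fm: "F m \<in> borel_measurable M" for m
    unfolding F_def using g by measurable
  have "\<bar>F m x\<bar> \<le> \<bar>G m x\<bar>" if "x \<in> space M" for m x
  proof -
    have "G m x = (\<Sum>j=1..m. if real (j - 1) < \<bar>g x\<bar> then 1 else 0)"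
      unfolding G_def by (intro sum.cong) (use that in \<open>auto simp: E\<close>)
    then show ?thesis
      using min_of_nat_le_count[of "\<bar>g x\<bar>" m] by (auto simp: F_def)
  qed
  then have FG: "AE x in M. \<bar>F m x\<bar> \<le> \<bar>G m x\<bar>" for m
    by auto
  have FX: "F m \<in> X" "N (F m) \<le> (C * K) powr (1 / \<rho>)" for m
    using X(7)[OF Fm GX FG] X(8)[OF Fm GX FG] NG order_trans by blast+
  have lim: "(\<lambda>m. F m x) \<longlonglongrightarrow> \<bar>g x\<bar>" for x
  proof (rule tendsto_eventually)
    obtain m0 :: nat where "\<bar>g x\<bar> \<le> real m0"
      using real_arch_simple by blast
    then show "\<forall>\<^sub>F m in sequentially. F m x = \<bar>g x\<bar>"
      unfolding eventually_sequentially F_def by (intro exI[of _ m0]) auto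
  qed
  have abs: "(\<lambda>x. \<bar>g x\<bar>) \<in> X \<and> N (\<lambda>x. \<bar>g x\<bar>) \<le> (C * K) powr (1 / \<rho>)"
  proof (rule quasi_banach_function_space_Fatou[OF q _ FX(1) _ FX(2)])
    show "(\<lambda>x. \<bar>g x\<bar>) \<in> borel_measurable M"
      using g by measurable
    show "AE x in M. (\<forall>j. 0 \<le> F j x) \<and> incseq (\<lambda>j. F j x) \<and> (\<lambda>j. F j x) \<longlonglongrightarrow> \<bar>g x\<bar>"
      using lim by (intro AE_I2 conjI) (auto simp: F_def incseq_def)
  qed
  then show ?thesis
    using X(7)[OF g, of "\<lambda>x. \<bar>g x\<bar>"] X(8)[OF g, of "\<lambda>x. \<bar>g x\<bar>"] by auto
qed

text \<open>On \<open>[\<gamma>\<^sup>k\<^sup>+\<^sup>1, \<gamma>\<^sup>k)\<close>, an interval of length \<open>\<gamma>\<^sup>k (1 - \<gamma>)\<close>, the integrand is at least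
  \<open>\<psi>(\<gamma>\<^sup>k\<^sup>+\<^sup>1) / \<gamma>\<^sup>k\<close>. Comparing with a step function makes the inequality independent of the measurability
  of the integrand.\<close>

lemma sum_geometric_le_nn_integral:
  fixes \<psi> :: "real \<Rightarrow> ennreal"
  assumes mono: "\<And>s t. s \<le> t \<Longrightarrow> \<psi> s \<le> \<psi> t" and \<gamma>: "0 < \<gamma>" "\<gamma> < 1"
  shows "(\<Sum>k<m. \<psi> (\<gamma> ^ Suc k) * ennreal (1 - \<gamma>)) \<le> (\<integral>\<^sup>+t\<in>{0<..<1}. (\<psi> t / ennreal t) \<partial>lborel)"
proof -
  define I where "I k = {\<gamma> ^ Suc k..<\<gamma> ^ k}" for k :: nat
  define c where "c k = \<psi> (\<gamma> ^ Suc k) / ennreal (\<gamma> ^ k)" for k :: nat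
  have I: "I k \<in> sets lborel" "emeasure lborel (I k) = ennreal (\<gamma> ^ k * (1 - \<gamma>))" for k
    using \<gamma> power_decreasing[of k "Suc k" \<gamma>] by (simp_all add: I_def algebra_simps)
  have "\<psi> (\<gamma> ^ Suc k) * ennreal (1 - \<gamma>) = c k * emeasure lborel (I k)" for k
  proof -
    have "c k * emeasure lborel (I k) = \<psi> (\<gamma> ^ Suc k) / ennreal (\<gamma> ^ k) * ennreal (\<gamma> ^ k) * ennreal (1 - \<gamma>)"
      using \<gamma> by (simp add: I c_def ennreal_mult mult.assoc)
    moreover have "\<psi> (\<gamma> ^ Suc k) / ennreal (\<gamma> ^ k) * ennreal (\<gamma> ^ k) = \<psi> (\<gamma> ^ Suc k)"
      using \<gamma> by (simp add: divide_ennreal_def mult.assoc inverse_ennreal flip: ennreal_mult)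
    ultimately show ?thesis by simp
  qed
  then have "(\<Sum>k<m. \<psi> (\<gamma> ^ Suc k) * ennreal (1 - \<gamma>)) = (\<integral>\<^sup>+t. (\<Sum>k<m. c k * indicator (I k) t) \<partial>lborel)"
    using I(1) by (subst nn_integral_sum) (simp_all add: nn_integral_cmult_indicator)
  also have "\<dots> \<le> (\<integral>\<^sup>+t\<in>{0<..<1}. (\<psi> t / ennreal t) \<partial>lborel)"
  proof (rule nn_integral_mono)
    fix t :: real
    show "(\<Sum>k<m. c k * indicator (I k) t) \<le> \<psi> t / ennreal t * indicator {0<..<1} t"
    proof (cases "\<exists>k<m. t \<in> I k")
      case True
      then obtain k where k: "k < m" "t \<in> I k" by auto
      have "t \<notin> I j" if "j \<noteq> k" for j
      proof
        assume j: "t \<in> I j"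
        have *: False if "i < i'" "t \<in> I i" "t \<in> I i'" for i i'
          using power_decreasing[of "Suc i" i' \<gamma>] \<gamma> that by (auto simp: I_def)
        from that j k(2) show False
          using *[of j k] *[of k j] by linarith
      qed
      then have "(\<Sum>k<m. c k * indicator (I k) t) = (\<Sum>j<m. if j = k then c k else 0)"
        using k by (intro sum.cong) auto
      also have "\<dots> = c k"
        using k by simp
      also have "\<gamma> ^ k \<le> 1" "0 < \<gamma> ^ Suc k"
        using \<gamma> by (auto intro: power_le_one)
      then have t: "0 < t" "t < 1" "\<gamma> ^ Suc k \<le> t" "t \<le> \<gamma> ^ k"
        using k by (auto simp: I_def)
      have "c k \<le> \<psi> t / ennreal t"
        unfolding c_def divide_ennreal_def
        using t by (intro mult_mono mono ennreal_leI) (auto simp: inverse_ennreal intro!: ennreal_leI le_imp_inverse_le)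
      finally show ?thesis
        using t by simp
    next
      case False
      then have "(\<Sum>k<m. c k * indicator (I k) t) = 0"
        by (intro sum.neutral) auto
      then show ?thesis by simp
    qed
  qed
  finally show ?thesis .
qed

lemma ennreal_powr_mono:
  assumes "x \<le> y" "r \<ge> 0"
  shows "ennreal_powr x r \<le> ennreal_powr y r"
proof (cases "y = \<infinity>")
  case False
  then have "x \<noteq> \<infinity>" using assms by (auto simp: top_unique)
  moreover have "enn2real x \<le> enn2real y"
    using assms False by (intro enn2real_mono) (auto simp: less_top)
  ultimately show ?thesis
    using False assms by (auto simp: ennreal_powr_def intro!: ennreal_leI powr_mono2)
qed (simp add: ennreal_powr_def)

lemma Psi_mono:
  fixes X :: "(real ^ 'n) set \<Rightarrow> (real ^ 'n \<Rightarrow> real) set"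
  assumes "s \<le> t"
  shows "Psi X N s \<le> Psi X N t"
  unfolding Psi_def
proof (rule SUP_mono, rule bexI, rule SUP_subset_mono)
  fix Q :: "(real ^ 'n) set" assume "Q \<in> cubes"
  then show "Q \<in> cubes" .
  have "s * measure lebesgue Q \<le> t * measure lebesgue Q"
    using assms by (intro mult_right_mono) auto
  then show "{E \<in> sets lebesgue. E \<subseteq> Q \<and> measure lebesgue E \<le> s * measure lebesgue Q}
      \<subseteq> {E \<in> sets lebesgue. E \<subseteq> Q \<and> measure lebesgue E \<le> t * measure lebesgue Q}"
    by auto
qed simp

text \<open>The standing assumptions on the family of spaces. The last one, a Dini condition on \<open>\<Psi>\<close>, is what makes
  the level set decomposition summable.\<close>

locale normalized_family =
  fixes X :: "(real ^ 'n) set \<Rightarrow> (real ^ 'n \<Rightarrow> real) set"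
    and N :: "(real ^ 'n) set \<Rightarrow> (real ^ 'n \<Rightarrow> real) \<Rightarrow> real"
    and c\<^sub>0 C\<^sub>0 \<rho> C\<^sub>\<rho> :: real
  assumes space: "Q \<in> cubes \<Longrightarrow> quasi_banach_function_space (lebesgue_on Q) (X Q) (N Q)"
    and c\<^sub>0: "0 < c\<^sub>0"
    and normalized: "Q \<in> cubes \<Longrightarrow>
           ennreal c\<^sub>0 \<le> qnorm (X Q) (N Q) (indicator Q) \<and>
           qnorm (X Q) (N Q) (indicator Q) \<le> ennreal C\<^sub>0"
    and \<rho>: "0 < \<rho>" and C\<^sub>\<rho>: "1 \<le> C\<^sub>\<rho>"
    and \<rho>_triangle: "\<And>Q (h :: nat \<Rightarrow> real ^ 'n \<Rightarrow> real) m. Q \<in> cubes \<Longrightarrow> (\<And>j. j \<in> {1..m} \<Longrightarrow> h j \<in> X Q) \<Longrightarrow>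
           N Q (\<lambda>x. \<Sum>j=1..m. h j x) powr \<rho> \<le> C\<^sub>\<rho> * (\<Sum>j=1..m. N Q (h j) powr \<rho>)"
    and Dini: "(\<integral>\<^sup>+t\<in>{0<..<1}. (ennreal_powr (Psi X N t) \<rho> / ennreal t) \<partial>lborel) < \<infinity>"
begin

lemma norm_indicator_cube:
  assumes "Q \<in> cubes"
  shows "indicator Q \<in> X Q" "c\<^sub>0 \<le> N Q (indicator Q)" "N Q (indicator Q) \<le> C\<^sub>0" "0 \<le> C\<^sub>0"
proof -
  show *: "indicator Q \<in> X Q"
    using normalized[OF assms] by (auto simp: qnorm_def top_unique split: if_splits)
  have "0 \<le> N Q (indicator Q)"
    by (rule quasi_banach_function_spaceD(6)[OF space[OF assms] *])
  then show "c\<^sub>0 \<le> N Q (indicator Q)"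
    using normalized[OF assms] * by (auto simp: qnorm_def)
  then have "0 < ennreal (N Q (indicator Q))"
    using c\<^sub>0 by simp
  also have "\<dots> \<le> ennreal C\<^sub>0"
    using normalized[OF assms] * by (auto simp: qnorm_def)
  finally show "0 \<le> C\<^sub>0"
    by simp
  then show "N Q (indicator Q) \<le> C\<^sub>0"
    using normalized[OF assms] * by (auto simp: qnorm_def)
qed

lemma norm_indicator_subset:
  assumes Q: "Q \<in> cubes" and E: "E \<in> sets lebesgue" "E \<subseteq> Q"
  shows "indicator E \<in> X Q" "N Q (indicator E) \<le> C\<^sub>0"
proof -
  have "(indicator E :: _ \<Rightarrow> real) \<in> borel_measurable (lebesgue_on Q)"
    using E(1) by (intro measurable_restrict_space1) simp
  moreover have "AE x in lebesgue_on Q. \<bar>indicator E x :: real\<bar> \<le> \<bar>indicator Q x\<bar>"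
    using E(2) by (auto split: split_indicator)
  ultimately show "indicator E \<in> X Q" "N Q (indicator E) \<le> C\<^sub>0"
    using quasi_banach_function_spaceD(7,8)[OF space[OF Q] _ norm_indicator_cube(1)[OF Q], of "indicator E"]
      norm_indicator_cube(3)[OF Q] by auto
qed

lemma norm_indicator_le_Psi:
  assumes Q: "Q \<in> cubes" and E: "E \<in> sets lebesgue" "E \<subseteq> Q"
    and le: "measure lebesgue E \<le> t * measure lebesgue Q"
  shows "ennreal (N Q (indicator E)) \<le> Psi X N t * ennreal C\<^sub>0"
proof -
  note EX = norm_indicator_subset(1)[OF Q E] and Q' = norm_indicator_cube[OF Q]
  have "qnorm (X Q) (N Q) (indicator E) / qnorm (X Q) (N Q) (indicator Q) \<le> Psi X N t"
    unfolding Psi_def by (intro SUP_upper2[OF Q] SUP_upper) (use E le in auto)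
  then have *: "ennreal (N Q (indicator E)) / ennreal (N Q (indicator Q)) \<le> Psi X N t"
    using EX Q' by (simp add: qnorm_def)
  have "ennreal (N Q (indicator E)) = ennreal (N Q (indicator E)) / ennreal (N Q (indicator Q)) * ennreal (N Q (indicator Q))"
    using quasi_banach_function_spaceD(6)[OF space[OF Q] EX] Q' c\<^sub>0
    by (simp add: divide_ennreal flip: ennreal_mult)
  also have "\<dots> \<le> Psi X N t * ennreal C\<^sub>0"
    using Q' by (intro mult_mono * ennreal_leI) auto
  finally show ?thesis .
qed

text \<open>Finiteness of the integral forces each \<open>\<Psi>(\<gamma>\<^sup>k)\<close> with \<open>k \<ge> 1\<close> to be finite, which justifies the real
  numbers \<open>p k\<close>.\<close>

lemma Psi_powr_summable:
  assumes "0 < \<gamma>" "\<gamma> < 1"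
  obtains p K where "\<And>k::nat. Psi X N (\<gamma> ^ Suc k) = ennreal (p k)" "\<And>k. p k \<ge> 0" "\<And>m. (\<Sum>k<m. p k powr \<rho>) \<le> K"
proof -
  define I where "I = (\<integral>\<^sup>+t\<in>{0<..<1}. (ennreal_powr (Psi X N t) \<rho> / ennreal t) \<partial>lborel)"
  define p where "p k = enn2real (Psi X N (\<gamma> ^ Suc k))" for k
  have le: "(\<Sum>k<m. ennreal_powr (Psi X N (\<gamma> ^ Suc k)) \<rho> * ennreal (1 - \<gamma>)) \<le> I" for m
    unfolding I_def using \<rho> assms
    by (intro sum_geometric_le_nn_integral ennreal_powr_mono Psi_mono) auto
  have "Psi X N (\<gamma> ^ Suc k) \<noteq> \<infinity>" for k
  proof
    assume "Psi X N (\<gamma> ^ Suc k) = \<infinity>"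
    then have "\<infinity> = ennreal_powr (Psi X N (\<gamma> ^ Suc k)) \<rho> * ennreal (1 - \<gamma>)"
      using assms by (simp add: ennreal_powr_def ennreal_top_mult)
    also have "ennreal_powr (Psi X N (\<gamma> ^ Suc k)) \<rho> * ennreal (1 - \<gamma>)
        \<le> (\<Sum>k<Suc k. ennreal_powr (Psi X N (\<gamma> ^ Suc k)) \<rho> * ennreal (1 - \<gamma>))"
      by (rule member_le_sum) auto
    also have "\<dots> \<le> I"
      by (rule le)
    finally show False
      using Dini by (simp add: I_def top_unique)
  qed
  then have Psi: "Psi X N (\<gamma> ^ Suc k) = ennreal (p k)" for k
    by (simp add: p_def less_top)
  have p: "p k \<ge> 0" for k
    by (simp add: p_def)
  have "(\<Sum>k<m. p k powr \<rho>) \<le> enn2real I / (1 - \<gamma>)" for m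
  proof -
    have "ennreal ((\<Sum>k<m. p k powr \<rho>) * (1 - \<gamma>)) = (\<Sum>k<m. ennreal (p k powr \<rho> * (1 - \<gamma>)))"
      using assms by (simp add: sum_distrib_right sum_nonneg)
    also have "\<dots> = (\<Sum>k<m. ennreal_powr (Psi X N (\<gamma> ^ Suc k)) \<rho> * ennreal (1 - \<gamma>))"
      using assms by (intro sum.cong) (auto simp: Psi p ennreal_powr_def ennreal_mult simp del: power_Suc)
    also have "\<dots> \<le> ennreal (enn2real I)"
      using le[of m] Dini by (simp add: I_def)
    finally have "(\<Sum>k<m. p k powr \<rho>) * (1 - \<gamma>) \<le> enn2real I"
      by (subst (asm) ennreal_le_iff) auto
    then show ?thesis
      using assms by (simp add: field_simps)
  qed
  then show thesis
    using Psi by (intro that[of p]) (auto simp: p_def)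
qed

text \<open>The quasi-norms of the indicators of the level sets are summable to the power \<open>\<rho>\<close>, uniformly in \<open>Q\<close>. The
  level \<open>k = 0\<close> is bounded by \<open>C\<^sub>0\<close> instead of by \<open>\<Psi>\<close>, because \<open>\<Psi>\<close> is controlled only at arguments
  below \<open>1\<close>.\<close>

lemma uniform_norm_bound_of_level_decay:
  assumes \<gamma>: "0 < \<gamma>" "\<gamma> < 1"
  obtains C where "C \<ge> 0" "\<And>Q g. Q \<in> cubes \<Longrightarrow> g \<in> borel_measurable (lebesgue_on Q) \<Longrightarrow>
    (\<And>k::nat. emeasure lebesgue {x \<in> Q. real k < \<bar>g x\<bar>} \<le> ennreal (\<gamma> ^ k) * emeasure lebesgue Q) \<Longrightarrow>
    g \<in> X Q \<and> N Q g \<le> C"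
proof -
  obtain p K where p: "\<And>k::nat. Psi X N (\<gamma> ^ Suc k) = ennreal (p k)" "\<And>k. p k \<ge> 0"
    and K: "\<And>m. (\<Sum>k<m. p k powr \<rho>) \<le> K"
    using Psi_powr_summable[OF \<gamma>] by blast
  define K' where "K' = C\<^sub>0 powr \<rho> * (1 + K)"
  show thesis
  proof (rule that[of "(C\<^sub>\<rho> * K') powr (1 / \<rho>)"])
    fix Q :: "(real ^ 'n) set" and g :: "real ^ 'n \<Rightarrow> real"
    assume Q: "Q \<in> cubes" and g: "g \<in> borel_measurable (lebesgue_on Q)"
      and decay: "\<And>k::nat. emeasure lebesgue {x \<in> Q. real k < \<bar>g x\<bar>} \<le> ennreal (\<gamma> ^ k) * emeasure lebesgue Q"
    define E where "E k = {x \<in> Q. real k < \<bar>g x\<bar>}" for k :: nat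
    have Qm: "Q \<in> sets lebesgue" "emeasure lebesgue Q = ennreal (measure lebesgue Q)"
      using cubes_lmeasurable(1)[OF Q] by (auto simp: emeasure_eq_measure2)
    have E_eq: "E k = {x \<in> space (lebesgue_on Q). real k < \<bar>g x\<bar>}" for k
      by (simp add: E_def)
    have "E k \<in> sets (lebesgue_on Q)" for k
      unfolding E_eq using g by measurable
    then have E: "E k \<in> sets lebesgue" "E k \<subseteq> Q" for k
      using Qm by (auto simp: sets_restrict_space_iff E_def)
    have meas: "measure lebesgue (E k) \<le> \<gamma> ^ k * measure lebesgue Q" for k
    proof -
      have "emeasure lebesgue (E k) \<le> ennreal (\<gamma> ^ k * measure lebesgue Q)"
        using decay[of k] \<gamma> by (simp add: E_def Qm ennreal_mult)
      then show ?thesis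
        unfolding measure_def using \<gamma> by (intro enn2real_leI) auto
    qed
    have N_nonneg: "0 \<le> N Q (indicator (E k))" for k
      by (rule quasi_banach_function_spaceD(6)[OF space[OF Q] norm_indicator_subset(1)[OF Q E]])
    note C\<^sub>0 = norm_indicator_cube(4)[OF Q]
    have N_Suc: "N Q (indicator (E (Suc k))) powr \<rho> \<le> C\<^sub>0 powr \<rho> * p k powr \<rho>" for k
    proof -
      have "ennreal (N Q (indicator (E (Suc k)))) \<le> ennreal (p k * C\<^sub>0)"
        using norm_indicator_le_Psi[OF Q E meas, of "Suc k"] p C\<^sub>0 by (simp add: ennreal_mult)
      then have "N Q (indicator (E (Suc k))) \<le> C\<^sub>0 * p k"
        using p C\<^sub>0 by (simp add: mult.commute)
      then have "N Q (indicator (E (Suc k))) powr \<rho> \<le> (C\<^sub>0 * p k) powr \<rho>"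
        using N_nonneg \<rho> by (intro powr_mono2) auto
      then show ?thesis
        using p C\<^sub>0 by (simp add: powr_mult)
    qed
    have N_0: "N Q (indicator (E 0)) powr \<rho> \<le> C\<^sub>0 powr \<rho>"
      using N_nonneg norm_indicator_subset(2)[OF Q E] \<rho> by (intro powr_mono2) auto
    have sum: "(\<Sum>k<m. N Q (indicator (E k)) powr \<rho>) \<le> K'" for m
    proof -
      have "(\<Sum>k<m. N Q (indicator (E k)) powr \<rho>) \<le> (\<Sum>k<Suc m. N Q (indicator (E k)) powr \<rho>)"
        by simp
      also have "\<dots> = N Q (indicator (E 0)) powr \<rho> + (\<Sum>k<m. N Q (indicator (E (Suc k))) powr \<rho>)"
        by (rule sum.lessThan_Suc_shift)
      also have "\<dots> \<le> C\<^sub>0 powr \<rho> + (\<Sum>k<m. C\<^sub>0 powr \<rho> * p k powr \<rho>)"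
        by (intro add_mono N_0 sum_mono N_Suc)
      also have "\<dots> = C\<^sub>0 powr \<rho> * (1 + (\<Sum>k<m. p k powr \<rho>))"
        by (simp add: distrib_left sum_distrib_left)
      also have "\<dots> \<le> K'"
        unfolding K'_def by (intro mult_left_mono add_left_mono K) auto
      finally show ?thesis .
    qed
    show "g \<in> X Q \<and> N Q g \<le> (C\<^sub>\<rho> * K') powr (1 / \<rho>)"
      by (rule norm_le_of_level_sets[OF space[OF Q] \<rho> _ \<rho>_triangle[OF Q] g E_eq
            norm_indicator_subset(1)[OF Q E] sum])
         (use C\<^sub>\<rho> in auto)
  qed simp
qed

text \<open>The decay of the overlap sets also shows that the sum is finite almost everywhere, so that it may be
  represented by a real-valued function.\<close>

lemma sparse_testing_finite:
  assumes \<eta>: "0 < \<eta>" "\<eta> < 1"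
  shows "sparse_testing X N \<eta> < \<infinity>"
proof -
  obtain C where C: "C \<ge> 0" "\<And>Q g. Q \<in> cubes \<Longrightarrow> g \<in> borel_measurable (lebesgue_on Q) \<Longrightarrow>
    (\<And>k::nat. emeasure lebesgue {x \<in> Q. real k < \<bar>g x\<bar>} \<le> ennreal ((1 - \<eta>) ^ k) * emeasure lebesgue Q) \<Longrightarrow>
    g \<in> X Q \<and> N Q g \<le> C"
    by (rule uniform_norm_bound_of_level_decay[of "1 - \<eta>"]) (use \<eta> in simp_all)
  have "sparse_testing X N \<eta> \<le> ennreal C"
    unfolding sparse_testing_def
  proof (intro SUP_least)
    fix Q :: "(real ^ 'n) set" and S
    assume Q: "Q \<in> cubes" and S: "S \<in> {S. S \<subseteq> dyadic Q \<and> sparse \<eta> S}"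
    define F where "F x = (\<Sum>\<^sub>\<infinity>P \<in> S. indicator P x :: ennreal)" for x
    have F [measurable]: "F \<in> borel_measurable lebesgue"
      and decay: "emeasure lebesgue {x \<in> Q. of_nat k < F x} \<le> ennreal ((1 - \<eta>) ^ k) * emeasure lebesgue Q" for k
      using sparse_sum_decay[OF Q _ _ \<eta>] S by (auto simp: F_def[abs_def])
    have Qm [measurable]: "Q \<in> sets lebesgue" and Q_eq: "emeasure lebesgue Q = ennreal (measure lebesgue Q)"
      using cubes_lmeasurable(1)[OF Q] by (auto simp: emeasure_eq_measure2)
    have level: "{x \<in> Q. of_nat k < F x} \<in> sets lebesgue" for k
    proof -
      have "{x \<in> Q. of_nat k < F x} = Q \<inter> {x \<in> space lebesgue. of_nat k < F x}"
        by auto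
      also have "\<dots> \<in> sets lebesgue"
        by measurable
      finally show ?thesis .
    qed
    define Z where "Z = {x \<in> Q. F x = \<infinity>}"
    have Zm: "Z \<in> sets lebesgue"
    proof -
      have "Z = Q \<inter> {x \<in> space lebesgue. F x = \<infinity>}"
        by (auto simp: Z_def)
      also have "\<dots> \<in> sets lebesgue"
        by measurable
      finally show ?thesis .
    qed
    have "emeasure lebesgue Z \<le> ennreal ((1 - \<eta>) ^ k * measure lebesgue Q)" for k
    proof -
      have "emeasure lebesgue Z \<le> emeasure lebesgue {x \<in> Q. of_nat k < F x}"
        by (intro emeasure_mono level) (auto simp: Z_def of_nat_less_top)
      then show ?thesis
        using decay[of k] \<eta> by (simp add: ennreal_mult Q_eq)
    qed
    moreover have "(\<lambda>k. ennreal ((1 - \<eta>) ^ k * measure lebesgue Q)) \<longlonglongrightarrow> ennreal (0 * measure lebesgue Q)"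
      using \<eta> by (intro tendsto_ennrealI tendsto_mult LIMSEQ_power_zero tendsto_const) auto
    ultimately have "emeasure lebesgue Z \<le> ennreal (0 * measure lebesgue Q)"
      by (intro LIMSEQ_le_const) auto
    then have "Z \<in> null_sets lebesgue"
      using Zm by auto
    then have "AE x in lebesgue. x \<in> Q \<longrightarrow> F x < \<infinity>"
      by (rule AE_not_in[THEN AE_mp]) (auto simp: Z_def less_top)
    then have fin: "AE x in lebesgue_on Q. F x < \<infinity>"
      by (simp add: AE_restrict_space_iff)
    have "(\<lambda>x. enn2real (F x)) \<in> X Q \<and> N Q (\<lambda>x. enn2real (F x)) \<le> C"
    proof (rule C(2)[OF Q])
      show "(\<lambda>x. enn2real (F x)) \<in> borel_measurable (lebesgue_on Q)"
        by (intro measurable_restrict_space1) measurable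
      fix k :: nat
      have "of_nat k < y" if "real k < enn2real y" for y
        using that by (cases y) (auto simp: ennreal_less_iff ennreal_of_nat_eq_real_of_nat)
      then have "emeasure lebesgue {x \<in> Q. real k < \<bar>enn2real (F x)\<bar>} \<le> emeasure lebesgue {x \<in> Q. of_nat k < F x}"
        by (intro emeasure_mono level) auto
      then show "emeasure lebesgue {x \<in> Q. real k < \<bar>enn2real (F x)\<bar>} \<le> ennreal ((1 - \<eta>) ^ k) * emeasure lebesgue Q"
        using decay by (rule order_trans)
    qed
    with fin have "qnorm_ennreal (lebesgue_on Q) (X Q) (N Q) F \<le> ennreal C"
      by (simp add: qnorm_ennreal_def qnorm_def ennreal_leI)
    then show "qnorm_ennreal (lebesgue_on Q) (X Q) (N Q) (\<lambda>x. \<Sum>\<^sub>\<infinity>P \<in> S. indicator P x) \<le> ennreal C"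
      by (simp add: F_def[abs_def])
  qed
  then show ?thesis
    by (rule le_less_trans) simp
qed

text \<open>By homogeneity the John--Nirenberg inequality for \<open>f\<close> is geometric decay for \<open>(f - \<langle>f\<rangle>\<^sub>Q) / M\<close>. It is
  applied with a number \<open>b > 0\<close> slightly larger than the \<open>BMO\<close> norm, which covers the functions of norm
  zero as well.\<close>

lemma BMO_continuously_embedded:
  "continuously_embedded BMO BMO_norm (BMO_X X N) (BMO_X_norm X N)"
proof -
  obtain C where C: "C \<ge> 0" "\<And>Q g. Q \<in> cubes \<Longrightarrow> g \<in> borel_measurable (lebesgue_on Q) \<Longrightarrow>
    (\<And>k::nat. emeasure lebesgue {x \<in> Q. real k < \<bar>g x\<bar>} \<le> ennreal ((1 / 2) ^ k) * emeasure lebesgue Q) \<Longrightarrow>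
    g \<in> X Q \<and> N Q g \<le> C"
    by (rule uniform_norm_bound_of_level_decay[of "1 / 2"]) simp_all
  define A where "A = C * 2 ^ (CARD('n) + 1)"
  have "A \<ge> 0"
    using C by (simp add: A_def)
  have le_b: "BMO_X_norm X N f \<le> ennreal (A * b)"
    if f: "f \<in> L1_loc" and b: "b > 0" and le: "BMO_norm f \<le> ennreal b" for f and b :: real
    unfolding BMO_X_norm_def
  proof (rule SUP_least)
    fix Q :: "(real ^ 'n) set" assume Q: "Q \<in> cubes"
    have osc: "average (\<lambda>x. \<bar>f x - average f P\<bar>) P \<le> b" if "P \<in> cubes" for P
    proof -
      have "ennreal (average (\<lambda>x. \<bar>f x - average f P\<bar>) P) \<le> BMO_norm f"
        unfolding BMO_norm_def by (rule SUP_upper[OF that])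
      then have "ennreal (average (\<lambda>x. \<bar>f x - average f P\<bar>) P) \<le> ennreal b"
        using le by (rule order_trans)
      then show ?thesis
        using b by (simp add: ennreal_le_iff)
    qed
    define M where "M = 2 ^ (CARD('n) + 1) * b"
    have M: "M > 0"
      using b by (simp add: M_def)
    define h where "h x = (f x - average f Q) * indicator Q x" for x
    have [measurable]: "f \<in> borel_measurable lebesgue"
      using f by (simp add: L1_loc_def)
    have [measurable]: "Q \<in> sets lebesgue"
      using cubes_lmeasurable(1)[OF Q] by auto
    have h: "h \<in> borel_measurable lebesgue"
      unfolding h_def by measurable
    have "(\<lambda>x. h x / M) \<in> X Q \<and> N Q (\<lambda>x. h x / M) \<le> C"
    proof (rule C(2)[OF Q])
      show "(\<lambda>x. h x / M) \<in> borel_measurable (lebesgue_on Q)"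
        using h by (intro measurable_restrict_space1 borel_measurable_divide borel_measurable_const)
      fix k :: nat
      have "{x \<in> Q. real k < \<bar>h x / M\<bar>} = {x \<in> Q. real k * M < \<bar>f x - average f Q\<bar>}"
        using M by (auto simp: h_def field_simps)
      then show "emeasure lebesgue {x \<in> Q. real k < \<bar>h x / M\<bar>} \<le> ennreal ((1 / 2) ^ k) * emeasure lebesgue Q"
        using John_Nirenberg[OF f b osc Q, of k] by (simp add: M_def)
    qed
    then have "(\<lambda>x. M * (h x / M)) \<in> X Q" "N Q (\<lambda>x. M * (h x / M)) \<le> M * C"
      using quasi_banach_function_spaceD(4,5)[OF space[OF Q], of "\<lambda>x. h x / M" M] M by auto
    moreover have "(\<lambda>x. M * (h x / M)) = h"
      using M by auto
    moreover have "M * C = A * b"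
      by (simp add: A_def M_def)
    ultimately have "h \<in> X Q" "N Q h \<le> A * b"
      by simp_all
    then show "qnorm (X Q) (N Q) (\<lambda>x. (f x - average f Q) * indicator Q x) \<le> ennreal (A * b)"
      by (simp add: qnorm_def h_def[abs_def] ennreal_leI)
  qed
  have le: "BMO_X_norm X N f \<le> ennreal A * BMO_norm f" if "f \<in> BMO" for f
  proof (rule ennreal_le_epsilon)
    fix e :: real assume e: "e > 0"
    have "f \<in> L1_loc" "BMO_norm f < top"
      using that by (auto simp: BMO_def)
    then have f: "f \<in> L1_loc" "BMO_norm f = ennreal (enn2real (BMO_norm f))"
      by simp_all
    \<comment> \<open>The surplus makes \<open>b\<close> positive and costs at most \<open>e\<close> after multiplication by \<open>A\<close>.\<close>
    define b where "b = enn2real (BMO_norm f) + e / (A + 1)"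
    have "e / (A + 1) > 0"
      using e \<open>A \<ge> 0\<close> by simp
    then have b: "b > 0" "BMO_norm f \<le> ennreal b"
      by (auto simp: b_def add_nonneg_pos intro!: order_trans[OF eq_refl[OF f(2)]] ennreal_leI)
    have "A * b \<le> A * enn2real (BMO_norm f) + e"
      using e \<open>A \<ge> 0\<close> by (simp add: b_def field_simps)
    then have "ennreal (A * b) \<le> ennreal A * BMO_norm f + ennreal e"
      using e \<open>A \<ge> 0\<close> f(2) by (metis enn2real_nonneg ennreal_leI ennreal_mult ennreal_plus less_imp_le mult_nonneg_nonneg)
    then show "BMO_X_norm X N f \<le> ennreal A * BMO_norm f + ennreal e"
      using le_b[OF f(1) b] by (rule order_trans[rotated])
  qed
  have "BMO \<subseteq> BMO_X X N"
  proof
    fix f :: "real ^ 'n \<Rightarrow> real" assume f: "f \<in> BMO"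
    have "ennreal A * BMO_norm f < \<infinity>"
      using f by (auto simp: BMO_def ennreal_mult_less_top)
    with le[OF f] show "f \<in> BMO_X X N"
      using f by (auto simp: BMO_X_def BMO_def intro: le_less_trans)
  qed
  with le \<open>A \<ge> 0\<close> show ?thesis
    unfolding continuously_embedded_def by blast
qed

end

theorem proposition4p4:
  fixes X :: "(real ^ 'n) set \<Rightarrow> (real ^ 'n \<Rightarrow> real) set"
    and N :: "(real ^ 'n) set \<Rightarrow> (real ^ 'n \<Rightarrow> real) \<Rightarrow> real"
    and c\<^sub>0 C\<^sub>0 \<rho> C\<^sub>\<rho> :: real
  assumes "\<And>Q. Q \<in> cubes \<Longrightarrow> quasi_banach_function_space (lebesgue_on Q) (X Q) (N Q)"
    and "0 < c\<^sub>0" and "c\<^sub>0 \<le> C\<^sub>0"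
    and "\<And>Q. Q \<in> cubes \<Longrightarrow>
           ennreal c\<^sub>0 \<le> qnorm (X Q) (N Q) (indicator Q) \<and>
           qnorm (X Q) (N Q) (indicator Q) \<le> ennreal C\<^sub>0"
    and "0 < \<rho>" and "\<rho> \<le> 1" and "1 \<le> C\<^sub>\<rho>"
    and "\<And>Q (h :: nat \<Rightarrow> real ^ 'n \<Rightarrow> real) m. Q \<in> cubes \<Longrightarrow> (\<And>j. j \<in> {1..m} \<Longrightarrow> h j \<in> X Q) \<Longrightarrow>
           N Q (\<lambda>x. \<Sum>j=1..m. h j x) powr \<rho> \<le> C\<^sub>\<rho> * (\<Sum>j=1..m. N Q (h j) powr \<rho>)"
    and "(\<integral>\<^sup>+t\<in>{0<..<1}. (ennreal_powr (Psi X N t) \<rho> / ennreal t) \<partial>lborel) < \<infinity>"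
  shows "(\<forall>\<eta>. 0 < \<eta> \<and> \<eta> < 1 \<longrightarrow> sparse_testing X N \<eta> < \<infinity>) \<and>
         continuously_embedded BMO BMO_norm (BMO_X X N) (BMO_X_norm X N)"
proof -
  interpret normalized_family X N c\<^sub>0 C\<^sub>0 \<rho> C\<^sub>\<rho>
    by unfold_locales (fact assms)+
  show ?thesis
    using sparse_testing_finite BMO_continuously_embedded by blast
qed

end
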